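(* Let $\Phi$ be an irreducible finite crystallographic root system with a fixed choice of positive roots. An element $w\in W(\Phi)$ is boolean if and only if $w$ avoids the linear patterns $s_1s_2s_1\in W(A_2)$, $s_2s_1s_3s_2\in W(A_3)$, and $s_2s_1s_3s_4s_2\in W(D_4)$.
   Context: $W(\Phi)$ is the Weyl group, $s_i$ the reflection in the simple root $\alpha_i$, and $I_\Phi(w)=\{\beta\in\Phi^+: w\beta\notin\Phi^+\}$ the inversion set. An element $w$ is boolean if the interval $[\mathrm{id},w]$ in the (strong) Bruhat order is isomorphic to a Boolean lattice. For root systems $R$, $\Phi$ with chosen positive roots and $\pi\in W(R)$, $w\in W(\Phi)$ contains the linear pattern $\pi$ if there is a linear map from the span of $R$ to the span of $\Phi$ sending $R^+$ into $\Phi^+$, $I_R(\pi)$ into $I_\Phi(w)$, and $R^+\setminus I_R(\pi)$ into $\Phi^+\setminus I_\Phi(w)$ (the map need not be injective); otherwise $w$ avoids $\pi$. Labelling: $A_2$ has simple roots $\alpha_1,\alpha_2$; $A_3$ has simple roots $\alpha_1,\alpha_2,\alpha_3$ forming a path with $\alpha_2$ in the middle; $D_4$ has simple roots $\alpha_1,\alpha_2,\alpha_3,\alpha_4$ with $\alpha_2$ the central node adjacent to the other three. *)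

theory Defs
  imports "HOL-Analysis.Analysis"
begin

section \<open>Root systems\<close>

definition root_refl :: "'a::euclidean_space \<Rightarrow> 'a \<Rightarrow> 'a" where
  "root_refl \<alpha> x = x - (2 * (x \<bullet> \<alpha>) / (\<alpha> \<bullet> \<alpha>)) *\<^sub>R \<alpha>"

text \<open>Root systems are reduced. They need not span the ambient space, so that type \<open>A\<^sub>n\<close>
  can be realised by the vectors \<open>e\<^sub>i - e\<^sub>j\<close>.\<close>

definition crystallographic_root_system :: "'a::euclidean_space set \<Rightarrow> bool" where
  "crystallographic_root_system \<Phi> \<longleftrightarrow>
     finite \<Phi> \<and> 0 \<notin> \<Phi> \<and>
     (\<forall>\<alpha>\<in>\<Phi>. \<forall>c. c *\<^sub>R \<alpha> \<in> \<Phi> \<longleftrightarrow> c = 1 \<or> c = -1) \<and>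
     (\<forall>\<alpha>\<in>\<Phi>. root_refl \<alpha> ` \<Phi> = \<Phi>) \<and>
     (\<forall>\<alpha>\<in>\<Phi>. \<forall>\<beta>\<in>\<Phi>. 2 * (\<beta> \<bullet> \<alpha>) / (\<alpha> \<bullet> \<alpha>) \<in> \<int>)"

definition irreducible_root_system :: "'a::euclidean_space set \<Rightarrow> bool" where
  "irreducible_root_system \<Phi> \<longleftrightarrow>
     \<Phi> \<noteq> {} \<and>
     \<not> (\<exists>\<Phi>1 \<Phi>2. \<Phi>1 \<noteq> {} \<and> \<Phi>2 \<noteq> {} \<and> \<Phi>1 \<union> \<Phi>2 = \<Phi> \<and> \<Phi>1 \<inter> \<Phi>2 = {} \<and>
          (\<forall>\<alpha>\<in>\<Phi>1. \<forall>\<beta>\<in>\<Phi>2. \<alpha> \<bullet> \<beta> = 0))"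

text \<open>A choice of positive roots: the roots on one side of a hyperplane containing no root.\<close>

definition positive_system :: "'a::euclidean_space set \<Rightarrow> 'a set \<Rightarrow> bool" where
  "positive_system \<Phi> P \<longleftrightarrow>
     (\<exists>v. (\<forall>\<alpha>\<in>\<Phi>. v \<bullet> \<alpha> \<noteq> 0) \<and> P = {\<alpha>\<in>\<Phi>. v \<bullet> \<alpha> > 0})"

definition simple_roots :: "'a::euclidean_space set \<Rightarrow> 'a set" where
  "simple_roots P = {\<alpha>\<in>P. \<not> (\<exists>\<beta>\<in>P. \<exists>\<gamma>\<in>P. \<alpha> = \<beta> + \<gamma>)}"


section \<open>Weyl group, length and Bruhat order\<close>

inductive_set weyl_group :: "'a::euclidean_space set \<Rightarrow> ('a \<Rightarrow> 'a) set"
  for \<Phi> :: "'a set" where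
  weyl_id: "id \<in> weyl_group \<Phi>"
| weyl_refl: "\<alpha> \<in> \<Phi> \<Longrightarrow> w \<in> weyl_group \<Phi> \<Longrightarrow> root_refl \<alpha> \<circ> w \<in> weyl_group \<Phi>"

text \<open>The word \<open>[\<alpha>\<^sub>1, \<dots>, \<alpha>\<^sub>k]\<close> denotes the product \<open>s\<^sub>1 \<circ> \<dots> \<circ> s\<^sub>k\<close>.\<close>

definition refl_prod :: "'a::euclidean_space list \<Rightarrow> 'a \<Rightarrow> 'a" where
  "refl_prod as = foldr (\<lambda>\<alpha> f. root_refl \<alpha> \<circ> f) as id"

definition weyl_length :: "'a::euclidean_space set \<Rightarrow> ('a \<Rightarrow> 'a) \<Rightarrow> nat" where
  "weyl_length P w =
     (LEAST n. \<exists>as. set as \<subseteq> simple_roots P \<and> length as = n \<and> w = refl_prod as)"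

definition bruhat_step ::
  "'a::euclidean_space set \<Rightarrow> 'a set \<Rightarrow> ('a \<Rightarrow> 'a) \<Rightarrow> ('a \<Rightarrow> 'a) \<Rightarrow> bool" where
  "bruhat_step \<Phi> P u v \<longleftrightarrow>
     u \<in> weyl_group \<Phi> \<and> (\<exists>\<alpha>\<in>\<Phi>. v = u \<circ> root_refl \<alpha>) \<and> weyl_length P u < weyl_length P v"

definition bruhat_le ::
  "'a::euclidean_space set \<Rightarrow> 'a set \<Rightarrow> ('a \<Rightarrow> 'a) \<Rightarrow> ('a \<Rightarrow> 'a) \<Rightarrow> bool" where
  "bruhat_le \<Phi> P = (bruhat_step \<Phi> P)\<^sup>*\<^sup>*"

definition bruhat_interval ::
  "'a::euclidean_space set \<Rightarrow> 'a set \<Rightarrow> ('a \<Rightarrow> 'a) \<Rightarrow> ('a \<Rightarrow> 'a) \<Rightarrow> ('a \<Rightarrow> 'a) set" where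
  "bruhat_interval \<Phi> P u v = {x \<in> weyl_group \<Phi>. bruhat_le \<Phi> P u x \<and> bruhat_le \<Phi> P x v}"

text \<open>Bruhat intervals are finite, so the Boolean lattices in question are, up to isomorphism,
  the lattices of all subsets of \<open>{0, \<dots>, n - 1}\<close>.\<close>

definition boolean_element :: "'a::euclidean_space set \<Rightarrow> 'a set \<Rightarrow> ('a \<Rightarrow> 'a) \<Rightarrow> bool" where
  "boolean_element \<Phi> P w \<longleftrightarrow>
     (\<exists>(n::nat) f. bij_betw f (bruhat_interval \<Phi> P id w) (Pow {..<n}) \<and>
        (\<forall>u\<in>bruhat_interval \<Phi> P id w. \<forall>v\<in>bruhat_interval \<Phi> P id w.
           bruhat_le \<Phi> P u v \<longleftrightarrow> f u \<subseteq> f v))"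


section \<open>Linear patterns\<close>

definition inversions :: "'a::euclidean_space set \<Rightarrow> ('a \<Rightarrow> 'a) \<Rightarrow> 'a set" where
  "inversions P w = {\<beta>\<in>P. w \<beta> \<notin> P}"

text \<open>The map is linear on \<open>span R\<close> only; its values elsewhere are irrelevant.\<close>

definition contains_pattern ::
  "'b::euclidean_space set \<Rightarrow> 'b set \<Rightarrow> ('b \<Rightarrow> 'b) \<Rightarrow>
   'a::euclidean_space set \<Rightarrow> 'a set \<Rightarrow> ('a \<Rightarrow> 'a) \<Rightarrow> bool" where
  "contains_pattern R Rp p \<Phi> P w \<longleftrightarrow>
     (\<exists>f. (\<forall>x\<in>span R. \<forall>y\<in>span R. f (x + y) = f x + f y) \<and>
          (\<forall>c. \<forall>x\<in>span R. f (c *\<^sub>R x) = c *\<^sub>R f x) \<and>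
          f ` span R \<subseteq> span \<Phi> \<and>
          f ` Rp \<subseteq> P \<and>
          f ` inversions Rp p \<subseteq> inversions P w \<and>
          f ` (Rp - inversions Rp p) \<subseteq> P - inversions P w)"

abbreviation avoids_pattern ::
  "'b::euclidean_space set \<Rightarrow> 'b set \<Rightarrow> ('b \<Rightarrow> 'b) \<Rightarrow>
   'a::euclidean_space set \<Rightarrow> 'a set \<Rightarrow> ('a \<Rightarrow> 'a) \<Rightarrow> bool" where
  "avoids_pattern R Rp p \<Phi> P w \<equiv> \<not> contains_pattern R Rp p \<Phi> P w"


section \<open>The root systems of types \<open>A\<^sub>2\<close>, \<open>A\<^sub>3\<close> and \<open>D\<^sub>4\<close>\<close>

text \<open>Coordinates are indexed from \<open>0\<close>: in the numeral types \<open>0 < 1 < \<dots> < n - 1\<close>, whereas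
  the index \<open>n\<close> would be \<open>0\<close>.\<close>

abbreviation evec :: "'n::finite \<Rightarrow> real ^ 'n" where
  "evec i \<equiv> axis i 1"

definition roots_A :: "(real ^ 'n::{finite,linorder}) set" where
  "roots_A = {evec i - evec j | i j. i \<noteq> j}"

definition pos_roots_A :: "(real ^ 'n::{finite,linorder}) set" where
  "pos_roots_A = {evec i - evec j | i j. i < j}"

definition roots_D :: "(real ^ 'n::{finite,linorder}) set" where
  "roots_D = {evec i - evec j | i j. i \<noteq> j} \<union> {evec i + evec j | i j. i \<noteq> j} \<union>
             {- evec i - evec j | i j. i \<noteq> j}"

definition pos_roots_D :: "(real ^ 'n::{finite,linorder}) set" where
  "pos_roots_D = {evec i - evec j | i j. i < j} \<union> {evec i + evec j | i j. i < j}"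

abbreviation "A2_roots \<equiv> roots_A :: (real ^ 3) set"
abbreviation "A2_pos \<equiv> pos_roots_A :: (real ^ 3) set"
abbreviation "A3_roots \<equiv> roots_A :: (real ^ 4) set"
abbreviation "A3_pos \<equiv> pos_roots_A :: (real ^ 4) set"
abbreviation "D4_roots \<equiv> roots_D :: (real ^ 4) set"
abbreviation "D4_pos \<equiv> pos_roots_D :: (real ^ 4) set"

text \<open>Simple roots are labelled from \<open>1\<close> in the standard order, the last one also serving as the value
  at irrelevant arguments; in type \<open>D\<^sub>4\<close> the central node is \<open>2\<close>.\<close>

definition A2_simple :: "nat \<Rightarrow> real ^ 3" where
  "A2_simple i = (if i = 1 then evec 0 - evec 1 else evec 1 - evec 2)"

definition A3_simple :: "nat \<Rightarrow> real ^ 4" where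
  "A3_simple i = (if i = 1 then evec 0 - evec 1 else if i = 2 then evec 1 - evec 2 else evec 2 - evec 3)"

definition D4_simple :: "nat \<Rightarrow> real ^ 4" where
  "D4_simple i = (if i = 1 then evec 0 - evec 1 else if i = 2 then evec 1 - evec 2
                  else if i = 3 then evec 2 - evec 3 else evec 2 + evec 3)"

definition A2_pattern :: "real ^ 3 \<Rightarrow> real ^ 3" where
  "A2_pattern = refl_prod (map A2_simple [1, 2, 1])"

definition A3_pattern :: "real ^ 4 \<Rightarrow> real ^ 4" where
  "A3_pattern = refl_prod (map A3_simple [2, 1, 3, 2])"

definition D4_pattern :: "real ^ 4 \<Rightarrow> real ^ 4" where
  "D4_pattern = refl_prod (map D4_simple [2, 1, 3, 4, 2])"

end

theory Submission
  imports Defs "HOL-Library.Sublist"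
begin

text \<open>An element is boolean iff no simple reflection is repeated in a reduced word \<open>xs\<close> of it: if the
  interval is a Boolean lattice of rank \<open>n\<close>, then the prefixes of \<open>xs\<close> form a chain, so
  \<open>length xs \<le> n\<close>, whereas the \<open>n\<close> atoms are letters of \<open>xs\<close>; conversely the subword property
  identifies the interval with the subsets of the set of letters.

  A word without repetitions avoids the patterns: removing its last letter \<open>\<alpha>\<close> preserves a pattern,
  since all other inversions, reflected in \<open>\<alpha>\<close>, have \<open>\<alpha>\<close>-coefficient \<open>0\<close>. For the converse, containing
  one of the three patterns is inherited upwards in both weak orders, so a minimal reduced word with a
  repetition has the form \<open>\<alpha> u \<alpha>\<close> with no letter repeated in \<open>\<alpha> u\<close>, and by minimality every letter
  of \<open>u\<close> that can be moved to either end of \<open>u\<close> is a neighbour of \<open>\<alpha>\<close> in the Dynkin diagram. As the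
  diagram has no cycles, \<open>u\<close> is a product of commuting neighbours of \<open>\<alpha>\<close>; by Bessel's inequality there
  are at most three, and the few possible Cartan integers are treated one by one.\<close>

section \<open>Reflections and simple roots\<close>

text \<open>A pattern prescribes non-inversions as well as inversions, so it need not survive when
  the inversion set grows, as an induction on words would like. The way out: every non-inversion of
  the A_3 and D_4 patterns is a difference of two inversions, so its loss creates an A_2 pattern.
  Hence only the disjunction \<open>has_pattern\<close> is inherited, not each pattern by itself.
  Three simply laced patterns suffice for all types because the linear map may identify simple
  roots. Folding A_3 gives B_2, and folding D_4 gives B_3 and G_2; this is the origin of the
  witnesses with repeated entries. Letters of a word are detected linearly: a word without the
  letter \<open>\<alpha>\<close> preserves the functional \<open>coef \<alpha>\<close>. This yields
  the support of an element, the reducedness of words without repetitions, and their avoidance of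
  patterns. Length is handled through the number of inversions, which changes by exactly one with
  each letter.\<close>

lemma linear_root_refl: "linear (root_refl \<alpha>)"
  by (rule linearI) (auto simp: root_refl_def inner_add_left algebra_simps add_divide_distrib)

text \<open>Division by zero yields zero, so \<open>root_refl 0\<close> is the identity and the case
  \<open>\<alpha> = 0\<close> is harmless.\<close>

lemma inner_root_refl [simp]: "root_refl \<alpha> x \<bullet> root_refl \<alpha> y = x \<bullet> y"
  by (cases "\<alpha> = 0")
     (auto simp: root_refl_def inner_diff_left inner_diff_right inner_commute field_simps)

lemma root_refl_self [simp]: "root_refl \<alpha> \<alpha> = - \<alpha>"
  by (cases "\<alpha> = 0") (auto simp: root_refl_def algebra_simps scaleR_2)

lemma root_refl_involutive [simp]: "root_refl \<alpha> (root_refl \<alpha> x) = x"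
proof -
  have "root_refl \<alpha> (root_refl \<alpha> x) = root_refl \<alpha> x - (2 * (x \<bullet> \<alpha>) / (\<alpha> \<bullet> \<alpha>)) *\<^sub>R root_refl \<alpha> \<alpha>"
    by (simp only: root_refl_def [of \<alpha> x] linear_diff [OF linear_root_refl] linear_scale [OF linear_root_refl])
  then show ?thesis by (simp add: root_refl_def)
qed

lemma root_refl_comp [simp]: "root_refl \<alpha> \<circ> root_refl \<alpha> = id" "root_refl \<alpha> \<circ> (root_refl \<alpha> \<circ> f) = f"
  by (auto simp: fun_eq_iff)

lemma root_refl_minus [simp]: "root_refl (- \<alpha>) = root_refl \<alpha>"
  by (simp add: root_refl_def fun_eq_iff)

lemma root_refl_orthogonal: "x \<bullet> \<alpha> = 0 \<Longrightarrow> root_refl \<alpha> x = x"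
  by (simp add: root_refl_def)

text \<open>The conjugation rule for reflections under an isometry \<open>g\<close>; commutation of
  orthogonal reflections, \<open>refl_prod_conj\<close> and strong exchange all come from
  it.\<close>

lemma root_refl_image:
  assumes "linear g" and "\<And>x y. g x \<bullet> g y = x \<bullet> y"
  shows "root_refl (g \<beta>) (g x) = g (root_refl \<beta> x)"
  by (simp add: root_refl_def assms linear_diff linear_scale)

lemma refl_prod_simps [simp]:
  "refl_prod [] = id" "refl_prod (x # xs) = root_refl x \<circ> refl_prod xs"
  by (simp_all add: refl_prod_def)

lemma refl_prod_append [simp]: "refl_prod (xs @ ys) = refl_prod xs \<circ> refl_prod ys"
  by (induction xs) auto

lemma linear_refl_prod: "linear (refl_prod xs)"
proof (induction xs)
  case Nil
  show ?case by (simp add: linear_iff)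
next
  case (Cons x xs)
  show ?case unfolding refl_prod_simps by (rule linear_compose [OF Cons linear_root_refl])
qed

lemmas refl_prod_linear [simp] =
  linear_add [OF linear_refl_prod] linear_diff [OF linear_refl_prod] linear_neg [OF linear_refl_prod]
  linear_scale [OF linear_refl_prod]
lemmas root_refl_linear [simp] =
  linear_add [OF linear_root_refl] linear_diff [OF linear_root_refl] linear_neg [OF linear_root_refl]
  linear_scale [OF linear_root_refl]

lemma inner_refl_prod [simp]: "refl_prod xs x \<bullet> refl_prod xs y = x \<bullet> y"
  by (induction xs) auto

lemma refl_prod_rev [simp]:
  "refl_prod xs (refl_prod (rev xs) x) = x" "refl_prod (rev xs) (refl_prod xs x) = x"
  by (induction xs arbitrary: x) auto

lemma refl_prod_rev_comp [simp]: "refl_prod (rev xs) \<circ> refl_prod xs = id"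
  by (auto simp: fun_eq_iff)

lemma refl_prod_conj: "refl_prod xs \<circ> root_refl \<beta> \<circ> refl_prod (rev xs) = root_refl (refl_prod xs \<beta>)"
proof
  fix x
  show "(refl_prod xs \<circ> root_refl \<beta> \<circ> refl_prod (rev xs)) x = root_refl (refl_prod xs \<beta>) x"
    using root_refl_image [OF linear_refl_prod [of xs] inner_refl_prod, where x = "refl_prod (rev xs) x" and \<beta>=\<beta>] by simp
qed

lemma root_refl_comm:
  assumes "\<alpha> \<bullet> \<beta> = 0"
  shows "root_refl \<alpha> (root_refl \<beta> x) = root_refl \<beta> (root_refl \<alpha> x)"
  using root_refl_image [OF linear_root_refl [of \<beta>] inner_root_refl, where \<beta>=\<alpha>] root_refl_orthogonal [OF assms]
  by metis

lemma refl_prod_move: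
  assumes "\<And>y. y \<in> set ys \<Longrightarrow> t \<bullet> y = 0"
  shows "refl_prod (t # ys) = refl_prod (ys @ [t])"
  using assms
proof (induction ys)
  case (Cons y ys)
  have IH: "refl_prod (t # ys) = refl_prod (ys @ [t])" by (rule Cons.IH) (simp add: Cons.prems)
  have ty: "t \<bullet> y = 0" by (simp add: Cons.prems)
  show ?case
  proof
    fix x
    show "refl_prod (t # y # ys) x = refl_prod ((y # ys) @ [t]) x"
      using root_refl_comm [OF ty, of "refl_prod ys x"] fun_cong [OF IH, of x] by simp
  qed
qed auto

text \<open>The vector \<open>v\<close> is a parameter so that \<open>v \<bullet> \<beta>\<close>
  can serve as a height: it decides signs by linearity and is the induction measure on positive
  roots.\<close>

locale positive_roots =
  fixes \<Phi> P :: "'a::euclidean_space set" and v :: 'a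
  assumes crystallographic: "crystallographic_root_system \<Phi>"
    and v_nonzero: "\<alpha> \<in> \<Phi> \<Longrightarrow> v \<bullet> \<alpha> \<noteq> 0"
    and P_eq: "P = {\<alpha> \<in> \<Phi>. v \<bullet> \<alpha> > 0}"
begin

abbreviation \<Delta> :: "'a set" where "\<Delta> \<equiv> simple_roots P"

lemma finite_roots: "finite \<Phi>" and zero_notin_roots: "0 \<notin> \<Phi>"
  and root_multiple: "\<alpha> \<in> \<Phi> \<Longrightarrow> c *\<^sub>R \<alpha> \<in> \<Phi> \<longleftrightarrow> c = 1 \<or> c = -1"
  and root_refl_root: "\<alpha> \<in> \<Phi> \<Longrightarrow> \<beta> \<in> \<Phi> \<Longrightarrow> root_refl \<alpha> \<beta> \<in> \<Phi>"
  and cartan_integer: "\<alpha> \<in> \<Phi> \<Longrightarrow> \<beta> \<in> \<Phi> \<Longrightarrow> 2 * (\<beta> \<bullet> \<alpha>) / (\<alpha> \<bullet> \<alpha>) \<in> \<int>"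
  using crystallographic by (force simp: crystallographic_root_system_def)+

lemma uminus_root [simp]: "- \<alpha> \<in> \<Phi> \<longleftrightarrow> \<alpha> \<in> \<Phi>"
  using root_multiple [of \<alpha> "-1"] root_multiple [of "-\<alpha>" "-1"] by auto

lemma pos_root: "\<beta> \<in> P \<Longrightarrow> \<beta> \<in> \<Phi>" and pos_inner: "\<beta> \<in> P \<Longrightarrow> v \<bullet> \<beta> > 0"
  and finite_pos: "finite P"
  using finite_roots by (auto simp: P_eq)

lemma notin_pos: "\<beta> \<in> \<Phi> \<Longrightarrow> \<beta> \<notin> P \<longleftrightarrow> - \<beta> \<in> P"
  using v_nonzero [of \<beta>] by (auto simp: P_eq)

lemma simple_pos: "\<alpha> \<in> \<Delta> \<Longrightarrow> \<alpha> \<in> P"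
  by (simp add: simple_roots_def)

lemma simple_root: "\<alpha> \<in> \<Delta> \<Longrightarrow> \<alpha> \<in> \<Phi>"
  by (simp add: simple_pos pos_root)

lemma finite_simple: "finite \<Delta>"
  using finite_pos by (simp add: simple_roots_def)

section \<open>Angles between roots, and the basis of simple roots\<close>

lemma root_inner_pos: "\<alpha> \<in> \<Phi> \<Longrightarrow> \<alpha> \<bullet> \<alpha> > 0"
  using zero_notin_roots by auto

lemma root_cauchy_schwarz:
  assumes "\<alpha> \<in> \<Phi>" "\<beta> \<in> \<Phi>" "\<beta> \<noteq> \<alpha>" "\<beta> \<noteq> - \<alpha>"
  shows "(\<alpha> \<bullet> \<beta>)\<^sup>2 < (\<alpha> \<bullet> \<alpha>) * (\<beta> \<bullet> \<beta>)"
proof -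
  \<comment> \<open>The component of \<open>\<beta>\<close> orthogonal to \<open>\<alpha>\<close>,
    scaled by \<open>\<alpha> \<bullet> \<alpha>\<close>; it is nonzero because the system is
    reduced, hence the strict inequality.\<close>
  let ?x = "(\<alpha> \<bullet> \<alpha>) *\<^sub>R \<beta> - (\<alpha> \<bullet> \<beta>) *\<^sub>R \<alpha>"
  have pos: "\<alpha> \<bullet> \<alpha> > 0" using assms root_inner_pos by auto
  have "?x \<noteq> 0"
  proof
    assume "?x = 0"
    then have "(\<alpha> \<bullet> \<alpha>) *\<^sub>R \<beta> = (\<alpha> \<bullet> \<beta>) *\<^sub>R \<alpha>" by simp
    then have "(1 / (\<alpha> \<bullet> \<alpha>)) *\<^sub>R ((\<alpha> \<bullet> \<alpha>) *\<^sub>R \<beta>) = (1 / (\<alpha> \<bullet> \<alpha>)) *\<^sub>R ((\<alpha> \<bullet> \<beta>) *\<^sub>R \<alpha>)" by simp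
    then have "\<beta> = ((\<alpha> \<bullet> \<beta>) / (\<alpha> \<bullet> \<alpha>)) *\<^sub>R \<alpha>" using pos by simp
    moreover define c where "c = (\<alpha> \<bullet> \<beta>) / (\<alpha> \<bullet> \<alpha>)"
    ultimately have c: "\<beta> = c *\<^sub>R \<alpha>" by simp
    then have "c = 1 \<or> c = -1" using assms root_multiple [of \<alpha> c] by blast
    then show False using assms c by auto
  qed
  then have "?x \<bullet> ?x > 0" by simp
  moreover have "?x \<bullet> ?x = (\<alpha> \<bullet> \<alpha>) * ((\<alpha> \<bullet> \<alpha>) * (\<beta> \<bullet> \<beta>) - (\<alpha> \<bullet> \<beta>)\<^sup>2)"
    by (simp add: inner_diff_left inner_diff_right inner_commute algebra_simps power2_eq_square)
  ultimately show ?thesis using pos by (simp add: zero_less_mult_iff)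
qed

text \<open>The Cartan integers \<open>p\<close> and \<open>q\<close> are positive with product at
  most 3, so one of them is 1, and the corresponding reflection produces the difference up to
  sign.\<close>

lemma root_diff:
  assumes "\<alpha> \<in> \<Phi>" "\<beta> \<in> \<Phi>" "\<alpha> \<noteq> \<beta>" "\<alpha> \<bullet> \<beta> > 0"
  shows "\<alpha> - \<beta> \<in> \<Phi>"
proof -
  have pos: "\<alpha> \<bullet> \<alpha> > 0" "\<beta> \<bullet> \<beta> > 0" using assms root_inner_pos by auto
  have "\<beta> \<noteq> - \<alpha>" using assms(4) pos(1) by (metis inner_minus_right neg_less_0_iff_less not_less_iff_gr_or_eq)
  then have less: "(\<alpha> \<bullet> \<beta>)\<^sup>2 < (\<alpha> \<bullet> \<alpha>) * (\<beta> \<bullet> \<beta>)" using root_cauchy_schwarz assms by auto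
  obtain p q :: int where p: "2 * (\<beta> \<bullet> \<alpha>) / (\<alpha> \<bullet> \<alpha>) = p" and q: "2 * (\<alpha> \<bullet> \<beta>) / (\<beta> \<bullet> \<beta>) = q"
    using cartan_integer assms unfolding Ints_def by blast
  have "real_of_int p > 0" "real_of_int q > 0" using p q assms pos by (auto simp: inner_commute simp flip: p q)
  moreover have "real_of_int (p * q) < 4"
    using less pos by (simp add: field_simps power2_eq_square inner_commute flip: p q)
  ultimately have pq: "p > 0" "q > 0" "p * q < 4" by linarith+
  then have "p = 1 \<or> q = 1"
    using mult_mono [of 2 p 2 q] by linarith
  then show ?thesis
  proof
    assume "q = 1"
    then have "root_refl \<beta> \<alpha> = \<alpha> - \<beta>" by (simp only: root_refl_def q) simp
    then show ?thesis using root_refl_root assms by metis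
  next
    assume "p = 1"
    then have "root_refl \<alpha> \<beta> = - (\<alpha> - \<beta>)" by (simp only: root_refl_def p) simp
    then show ?thesis using root_refl_root assms uminus_root by metis
  qed
qed

lemma simple_inner_nonpos:
  assumes "\<alpha> \<in> \<Delta>" "\<beta> \<in> \<Delta>" "\<alpha> \<noteq> \<beta>"
  shows "\<alpha> \<bullet> \<beta> \<le> 0"
proof (rule ccontr)
  assume "\<not> ?thesis"
  then have "\<alpha> - \<beta> \<in> \<Phi>" using assms root_diff simple_root by auto
  then have "\<alpha> - \<beta> \<in> P \<or> \<beta> - \<alpha> \<in> P" using notin_pos by fastforce
  moreover have "\<alpha> = \<beta> + (\<alpha> - \<beta>)" "\<beta> = \<alpha> + (\<beta> - \<alpha>)" by auto
  ultimately show False using assms unfolding simple_roots_def by blast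
qed

text \<open>Heights are real numbers; well-foundedness comes from the finiteness of
  \<open>P\<close>, the measure being the number of positive roots of smaller height.\<close>

lemma pos_induct [consumes 1]:
  assumes "\<beta> \<in> P" and "\<And>\<beta>. \<beta> \<in> P \<Longrightarrow> (\<And>\<gamma>. \<gamma> \<in> P \<Longrightarrow> v \<bullet> \<gamma> < v \<bullet> \<beta> \<Longrightarrow> Q \<gamma>) \<Longrightarrow> Q \<beta>"
  shows "Q \<beta>"
  using assms(1)
proof (induction "card {\<gamma> \<in> P. v \<bullet> \<gamma> < v \<bullet> \<beta>}" arbitrary: \<beta> rule: less_induct)
  case less
  show ?case
  proof (rule assms(2) [OF less.prems])
    fix \<gamma> assume g: "\<gamma> \<in> P" "v \<bullet> \<gamma> < v \<bullet> \<beta>"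
    have "card {\<delta> \<in> P. v \<bullet> \<delta> < v \<bullet> \<gamma>} < card {\<delta> \<in> P. v \<bullet> \<delta> < v \<bullet> \<beta>}"
      by (rule psubset_card_mono) (use g finite_pos in auto)
    then show "Q \<gamma>" using less g by auto
  qed
qed

lemma pos_add_induct [consumes 1, case_names simple add]:
  assumes "\<beta> \<in> P" and simple: "\<And>\<alpha>. \<alpha> \<in> \<Delta> \<Longrightarrow> Q \<alpha>"
    and add: "\<And>\<beta> \<gamma>. \<beta> \<in> P \<Longrightarrow> \<gamma> \<in> P \<Longrightarrow> Q \<beta> \<Longrightarrow> Q \<gamma> \<Longrightarrow> Q (\<beta> + \<gamma>)"
  shows "Q \<beta>"
  using assms(1)
proof (induction rule: pos_induct)
  case (1 \<beta>)
  show ?case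
  proof (cases "\<beta> \<in> \<Delta>")
    case False
    then obtain \<gamma> \<delta> where gd: "\<gamma> \<in> P" "\<delta> \<in> P" "\<beta> = \<gamma> + \<delta>" using 1 by (auto simp: simple_roots_def)
    then have "v \<bullet> \<gamma> < v \<bullet> \<beta>" "v \<bullet> \<delta> < v \<bullet> \<beta>" using pos_inner by (auto simp: inner_add_right)
    then show ?thesis using add 1 gd by auto
  qed (rule simple)
qed

text \<open>Split the relation by the sign of its coefficients. Obtuse angles give
  \<open>y \<bullet> y \<le> 0\<close> for the positive part \<open>y\<close>, while
  \<open>v \<bullet> y > 0\<close> if that part is nonempty. Applied to a relation and its negative,
  this yields independence.\<close>

lemma obtuse_part_zero:
  assumes "(\<Sum>\<gamma>\<in>\<Delta>. f \<gamma> *\<^sub>R \<gamma>) = 0" "\<alpha> \<in> \<Delta>"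
  shows "f \<alpha> \<le> 0"
proof (rule ccontr)
  assume "\<not> ?thesis"
  define A B where "A = {\<gamma> \<in> \<Delta>. f \<gamma> > 0}" and "B = {\<gamma> \<in> \<Delta>. \<not> f \<gamma> > 0}"
  have fin: "finite A" "finite B" using finite_simple by (auto simp: A_def B_def)
  define y where "y = (\<Sum>\<gamma>\<in>A. f \<gamma> *\<^sub>R \<gamma>)"
  have "\<Delta> = A \<union> B" "A \<inter> B = {}" by (auto simp: A_def B_def)
  then have "y + (\<Sum>\<gamma>\<in>B. f \<gamma> *\<^sub>R \<gamma>) = 0" using assms(1) fin
    by (simp add: sum.union_disjoint y_def)
  then have y2: "y = - (\<Sum>\<gamma>\<in>B. f \<gamma> *\<^sub>R \<gamma>)" by (simp add: add_eq_0_iff2)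
  have "y \<bullet> y = (\<Sum>\<gamma>\<in>A. f \<gamma> *\<^sub>R \<gamma>) \<bullet> (- (\<Sum>\<gamma>\<in>B. f \<gamma> *\<^sub>R \<gamma>))"
    using y2 y_def by simp
  also have "\<dots> = (\<Sum>\<gamma>\<in>A. f \<gamma> * (\<gamma> \<bullet> (- (\<Sum>\<delta>\<in>B. f \<delta> *\<^sub>R \<delta>))))"
    unfolding inner_sum_left inner_scaleR_left ..
  also have "\<dots> = (\<Sum>\<gamma>\<in>A. \<Sum>\<delta>\<in>B. f \<gamma> * (- f \<delta>) * (\<gamma> \<bullet> \<delta>))"
    by (intro sum.cong refl)
       (simp add: inner_sum_right sum_negf sum_distrib_left mult.assoc)
  also have "\<dots> \<le> 0"
  proof (intro sum_nonpos)
    fix \<gamma> \<delta> assume "\<gamma> \<in> A" "\<delta> \<in> B"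
    then show "f \<gamma> * (- f \<delta>) * (\<gamma> \<bullet> \<delta>) \<le> 0"
      using simple_inner_nonpos [of \<gamma> \<delta>] by (intro mult_nonneg_nonpos) (auto simp: A_def B_def mult_le_0_iff)
  qed
  finally have "y = 0" using inner_ge_zero [of y] by simp
  moreover have "v \<bullet> y > 0"
    unfolding y_def inner_sum_right
    by (rule sum_pos) (use fin \<open>\<alpha> \<in> \<Delta>\<close> \<open>\<not> f \<alpha> \<le> 0\<close> pos_inner simple_pos in \<open>auto simp: A_def\<close>)
  ultimately show False by simp
qed

lemma independent_simple: "independent \<Delta>"
proof (rule independent_if_scalars_zero [OF finite_simple])
  fix f \<alpha> assume *: "(\<Sum>\<gamma>\<in>\<Delta>. f \<gamma> *\<^sub>R \<gamma>) = 0" "\<alpha> \<in> \<Delta>"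
  then have "(\<Sum>\<gamma>\<in>\<Delta>. (- f \<gamma>) *\<^sub>R \<gamma>) = 0" by (simp add: sum_negf)
  then show "f \<alpha> = 0" using obtuse_part_zero [of f] obtuse_part_zero [of "\<lambda>\<gamma>. - f \<gamma>"] * by fastforce
qed

text \<open>The coefficient of a simple root \<open>\<alpha>\<close>, extended to the whole space in
  an arbitrary way so that linearity holds without side conditions.\<close>

definition coef :: "'a \<Rightarrow> 'a \<Rightarrow> real" where
  "coef \<alpha> = (SOME c. linear c \<and> (\<forall>\<beta>\<in>\<Delta>. c \<beta> = (if \<beta> = \<alpha> then 1 else 0)))"

lemma coef_spec: "linear (coef \<alpha>) \<and> (\<forall>\<beta>\<in>\<Delta>. coef \<alpha> \<beta> = (if \<beta> = \<alpha> then 1 else 0))"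
  unfolding coef_def
  using linear_independent_extend [OF independent_simple, of "\<lambda>\<beta>. if \<beta> = \<alpha> then 1 else 0"]
  by (rule someI_ex)

lemma linear_coef: "linear (coef \<alpha>)"
  and coef_simple: "\<beta> \<in> \<Delta> \<Longrightarrow> coef \<alpha> \<beta> = (if \<beta> = \<alpha> then 1 else 0)"
  using coef_spec by auto

lemmas coef_linear [simp] =
  linear_add [OF linear_coef] linear_diff [OF linear_coef] linear_neg [OF linear_coef]
  linear_scale [OF linear_coef]

lemma coef_nonneg: "\<beta> \<in> P \<Longrightarrow> coef \<alpha> \<beta> \<ge> 0"
  by (induction rule: pos_add_induct) (auto simp: coef_simple)

lemma pos_expansion: "\<beta> \<in> P \<Longrightarrow> \<beta> = (\<Sum>\<gamma>\<in>\<Delta>. coef \<gamma> \<beta> *\<^sub>R \<gamma>)"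
proof (induction rule: pos_add_induct)
  case (simple \<alpha>)
  have "(\<Sum>\<gamma>\<in>\<Delta>. coef \<gamma> \<alpha> *\<^sub>R \<gamma>) = (\<Sum>\<gamma>\<in>\<Delta>. if \<gamma> = \<alpha> then \<alpha> else 0)"
    using simple by (intro sum.cong) (auto simp: coef_simple)
  then show ?case using simple finite_simple by simp
next
  case (add \<beta> \<gamma>)
  then show ?case by (simp add: scaleR_add_left sum.distrib)
qed

lemma coef_root_refl: "\<alpha> \<noteq> \<gamma> \<Longrightarrow> \<alpha> \<in> \<Delta> \<Longrightarrow> coef \<gamma> (root_refl \<alpha> x) = coef \<gamma> x"
  by (simp add: root_refl_def coef_simple)

text \<open>The invariant behind all support arguments: a reflection alters a vector only by a
  multiple of its root.\<close>

lemma coef_refl_prod: "set xs \<subseteq> \<Delta> \<Longrightarrow> \<gamma> \<notin> set xs \<Longrightarrow> coef \<gamma> (refl_prod xs x) = coef \<gamma> x"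
  by (induction xs) (auto simp: coef_root_refl)

end

section \<open>Reduced words and the Bruhat order\<close>

lemma subseq_subset: "subseq xs ys \<Longrightarrow> set xs \<subseteq> set ys"
  by (induction rule: list_emb.induct) auto

context positive_roots
begin

text \<open>Only the \<open>\<alpha>\<close>-coefficient changes. If the image were negative, all
  other coefficients of \<open>\<beta>\<close> would vanish, making \<open>\<beta>\<close> a
  positive multiple of \<open>\<alpha>\<close>.\<close>

lemma simple_refl_pos:
  assumes "\<alpha> \<in> \<Delta>" "\<beta> \<in> P" "\<beta> \<noteq> \<alpha>"
  shows "root_refl \<alpha> \<beta> \<in> P"
proof (rule ccontr)
  assume "root_refl \<alpha> \<beta> \<notin> P"
  then have neg: "- root_refl \<alpha> \<beta> \<in> P" using assms notin_pos root_refl_root pos_root simple_root by auto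
  have "coef \<gamma> \<beta> = 0" if "\<gamma> \<noteq> \<alpha>" for \<gamma>
    using coef_nonneg [OF neg, of \<gamma>] coef_nonneg [OF assms(2), of \<gamma>] coef_root_refl [of \<alpha> \<gamma>] that assms by auto
  then have "(\<Sum>\<gamma>\<in>\<Delta>. coef \<gamma> \<beta> *\<^sub>R \<gamma>) = (\<Sum>\<gamma>\<in>\<Delta>. if \<gamma> = \<alpha> then coef \<alpha> \<beta> *\<^sub>R \<alpha> else 0)"
    by (intro sum.cong) auto
  then have "\<beta> = (\<Sum>\<gamma>\<in>\<Delta>. if \<gamma> = \<alpha> then coef \<alpha> \<beta> *\<^sub>R \<alpha> else 0)"
    using pos_expansion [OF assms(2)] by simp
  then have b: "\<beta> = coef \<alpha> \<beta> *\<^sub>R \<alpha>" using assms finite_simple by simp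
  then have "coef \<alpha> \<beta> = 1 \<or> coef \<alpha> \<beta> = -1"
    using root_multiple [OF simple_root [OF assms(1)], of "coef \<alpha> \<beta>"] pos_root [OF assms(2)] by auto
  then show False using b assms coef_nonneg [OF assms(2), of \<alpha>] by auto
qed

text \<open>The positive number \<open>\<beta> \<bullet> \<beta>\<close> is a nonnegative
  combination of the products of \<open>\<beta>\<close> with the simple roots.\<close>

lemma simple_descent:
  assumes "\<beta> \<in> P"
  obtains \<alpha> where "\<alpha> \<in> \<Delta>" "\<beta> \<bullet> \<alpha> > 0"
proof (rule ccontr)
  assume "\<not> thesis"
  then have *: "\<beta> \<bullet> \<alpha> \<le> 0" if "\<alpha> \<in> \<Delta>" for \<alpha> using that \<open>\<And>\<alpha>. \<alpha> \<in> \<Delta> \<Longrightarrow> \<beta> \<bullet> \<alpha> > 0 \<Longrightarrow> thesis\<close> by force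
  have "\<beta> \<bullet> \<beta> = \<beta> \<bullet> (\<Sum>\<gamma>\<in>\<Delta>. coef \<gamma> \<beta> *\<^sub>R \<gamma>)" using pos_expansion [OF assms] by simp
  also have "\<dots> \<le> 0" unfolding inner_sum_right
    by (rule sum_nonpos) (use * coef_nonneg [OF assms] in \<open>auto simp: mult_le_0_iff\<close>)
  finally show False using root_inner_pos [OF pos_root [OF assms]] by simp
qed

text \<open>Conjugation by a simple reflection that lowers the height of \<open>\<beta>\<close>
  reduces to a smaller positive root.\<close>

lemma root_refl_simple_word:
  assumes "\<beta> \<in> P"
  shows "\<exists>xs. set xs \<subseteq> \<Delta> \<and> root_refl \<beta> = refl_prod xs"
  using assms
proof (induction rule: pos_induct)
  case (1 \<beta>)
  obtain \<alpha> where a: "\<alpha> \<in> \<Delta>" "\<beta> \<bullet> \<alpha> > 0" using simple_descent 1 by blast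
  show ?case
  proof (cases "\<beta> = \<alpha>")
    case True
    then show ?thesis using a by (intro exI [of _ "[\<alpha>]"]) auto
  next
    case False
    let ?b = "root_refl \<alpha> \<beta>"
    have "?b \<in> P" using simple_refl_pos a 1 False by auto
    moreover have "v \<bullet> ?b < v \<bullet> \<beta>"
      using a pos_inner [OF simple_pos [OF a(1)]] root_inner_pos [OF simple_root [OF a(1)]]
      by (simp add: root_refl_def inner_diff_right)
    ultimately obtain xs where xs: "set xs \<subseteq> \<Delta>" "root_refl ?b = refl_prod xs" using 1 by blast
    have "root_refl \<beta> = refl_prod ([\<alpha>] @ xs @ [\<alpha>])"
      using refl_prod_conj [of "[\<alpha>]" ?b] xs by (simp add: comp_assoc)
    then show ?thesis using xs a by (intro exI [of _ "[\<alpha>] @ xs @ [\<alpha>]"]) auto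
  qed
qed

lemma weyl_group_word:
  assumes "w \<in> weyl_group \<Phi>"
  shows "\<exists>xs. set xs \<subseteq> \<Delta> \<and> w = refl_prod xs"
  using assms
proof (induction rule: weyl_group.induct)
  case weyl_id
  show ?case by (rule exI [of _ "[]"]) simp
next
  case (weyl_refl \<alpha> w)
  obtain xs where xs: "set xs \<subseteq> \<Delta>" "w = refl_prod xs" using weyl_refl by blast
  have "\<exists>ys. set ys \<subseteq> \<Delta> \<and> root_refl \<alpha> = refl_prod ys"
    using root_refl_simple_word [of \<alpha>] root_refl_simple_word [of "-\<alpha>"] notin_pos weyl_refl(1)
    unfolding root_refl_minus by blast
  then obtain ys where ys: "set ys \<subseteq> \<Delta>" "root_refl \<alpha> = refl_prod ys" by blast
  show ?case by (rule exI [of _ "ys @ xs"]) (use xs ys in auto)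
qed

lemma refl_prod_weyl_group: "set xs \<subseteq> \<Phi> \<Longrightarrow> refl_prod xs \<in> weyl_group \<Phi>"
  by (induction xs) (auto intro: weyl_group.intros)

lemma refl_prod_root: "set xs \<subseteq> \<Phi> \<Longrightarrow> \<beta> \<in> \<Phi> \<Longrightarrow> refl_prod xs \<beta> \<in> \<Phi>"
  by (induction xs) (auto intro: root_refl_root)

lemma word_root: "set xs \<subseteq> \<Delta> \<Longrightarrow> \<beta> \<in> \<Phi> \<Longrightarrow> refl_prod xs \<beta> \<in> \<Phi>"
  using refl_prod_root simple_root by (meson subset_iff)

lemma word_weyl_group: "set xs \<subseteq> \<Delta> \<Longrightarrow> refl_prod xs \<in> weyl_group \<Phi>"
  using refl_prod_weyl_group simple_root by (meson subset_iff)

text \<open>As \<open>\<beta>\<close> is carried through the word from the right, some letter turns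
  its positive image negative. That image must equal the letter, by \<open>simple_refl_pos\<close>,
  and conjugation cancels it.\<close>

lemma strong_exchange:
  assumes "set xs \<subseteq> \<Delta>" "\<beta> \<in> inversions P (refl_prod xs)"
  shows "\<exists>ys y zs. xs = ys @ y # zs \<and> refl_prod xs \<circ> root_refl \<beta> = refl_prod (ys @ zs)"
  using assms
proof (induction xs)
  case Nil
  then show ?case by (simp add: inversions_def)
next
  case (Cons x xs)
  show ?case
  proof (cases "refl_prod xs \<beta> \<in> P")
    case True
    then have "refl_prod xs \<beta> = x"
      using Cons.prems simple_refl_pos [of x "refl_prod xs \<beta>"] by (auto simp: inversions_def)
    then have "refl_prod (x # xs) \<circ> root_refl \<beta> = refl_prod xs"
      using root_refl_image [OF linear_refl_prod [of xs] inner_refl_prod, of \<beta>, symmetric]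
      by (intro ext) simp
    then have "x # xs = [] @ x # xs \<and> refl_prod (x # xs) \<circ> root_refl \<beta> = refl_prod ([] @ xs)"
      unfolding append_Nil by blast
    then show ?thesis by blast
  next
    case False
    then have *: "\<beta> \<in> inversions P (refl_prod xs)" "set xs \<subseteq> \<Delta>"
      using Cons.prems by (auto simp: inversions_def)
    from Cons.IH [OF *(2,1)] obtain ys y zs
      where "xs = ys @ y # zs" "refl_prod xs \<circ> root_refl \<beta> = refl_prod (ys @ zs)"
      by blast
    then have "x # xs = (x # ys) @ y # zs"
      "refl_prod (x # xs) \<circ> root_refl \<beta> = refl_prod ((x # ys) @ zs)"
      by (simp, metis append_Cons comp_assoc refl_prod_simps(2))
    then show ?thesis by blast
  qed
qed

section \<open>Inversion counts, reduced words and length\<close>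

lemma uminus_notin_pos: "\<beta> \<in> P \<Longrightarrow> - \<beta> \<notin> P"
  by (auto simp: P_eq)

lemma finite_inversions: "finite (inversions P w)"
  using finite_pos by (simp add: inversions_def)

text \<open>The extra letter changes the sign only of roots that \<open>xs\<close> maps to
  \<open>x\<close> or \<open>- x\<close>, and the positive one among them is
  \<open>refl_prod (rev xs) x\<close>.\<close>

lemma inversions_Cons:
  assumes "set xs \<subseteq> \<Delta>" "x \<in> \<Delta>" and \<gamma>: "refl_prod (rev xs) x \<in> P"
  shows "inversions P (refl_prod (x # xs)) = insert (refl_prod (rev xs) x) (inversions P (refl_prod xs))"
    and "refl_prod (rev xs) x \<notin> inversions P (refl_prod xs)"
proof -
  let ?w = "refl_prod xs" and ?g = "refl_prod (rev xs) x"
  show "?g \<notin> inversions P ?w" using assms(2) by (simp add: inversions_def simple_pos)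
  have "root_refl x (?w \<beta>) \<notin> P \<longleftrightarrow> \<beta> = ?g \<or> ?w \<beta> \<notin> P" if b: "\<beta> \<in> P" for \<beta>
  proof (cases "?w \<beta> \<in> P")
    case True
    show ?thesis
    proof (cases "?w \<beta> = x")
      case True
      then have "\<beta> = ?g" using refl_prod_rev(2) [of xs \<beta>] by simp
      then show ?thesis using assms(2) uminus_notin_pos simple_pos by simp
    next
      case False
      then show ?thesis using True simple_refl_pos assms(2) by auto
    qed
  next
    case False
    then have neg: "- ?w \<beta> \<in> P" using notin_pos word_root assms(1) b pos_root by blast
    have "- ?w \<beta> \<noteq> x"
    proof
      assume "- ?w \<beta> = x"
      then have "?w (- \<beta>) = x" by simp
      then have "- \<beta> = ?g" using refl_prod_rev(2) [of xs "-\<beta>"] by metis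
      then show False using \<gamma> b uminus_notin_pos by metis
    qed
    then have "- root_refl x (?w \<beta>) \<in> P" using simple_refl_pos [OF assms(2) neg] by simp
    then show ?thesis using False uminus_notin_pos by fastforce
  qed
  then show "inversions P (refl_prod (x # xs)) = insert ?g (inversions P ?w)"
    using \<gamma> by (auto simp: inversions_def)
qed

lemma card_inversions_Cons:
  assumes "set xs \<subseteq> \<Delta>" "x \<in> \<Delta>"
  shows "refl_prod (rev xs) x \<in> P \<Longrightarrow>
      card (inversions P (refl_prod (x # xs))) = Suc (card (inversions P (refl_prod xs)))"
    and "refl_prod (rev xs) x \<notin> P \<Longrightarrow>
      card (inversions P (refl_prod xs)) = Suc (card (inversions P (refl_prod (x # xs))))"
proof -
  show "refl_prod (rev xs) x \<in> P \<Longrightarrow>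
      card (inversions P (refl_prod (x # xs))) = Suc (card (inversions P (refl_prod xs)))"
    using inversions_Cons [OF assms] finite_inversions by (simp only: card_insert_disjoint not_False_eq_True)
  assume "refl_prod (rev xs) x \<notin> P"
  \<comment> \<open>The negative case is the positive case for \<open>x # xs\<close>: another letter
    \<open>x\<close> leads back to \<open>xs\<close>.\<close>
  then have *: "refl_prod (rev (x # xs)) x \<in> P"
    using notin_pos word_root [of "rev xs" x] assms simple_root by simp
  have "refl_prod (x # x # xs) = refl_prod xs" by simp
  moreover have "set (x # xs) \<subseteq> \<Delta>" using assms by simp
  ultimately show "card (inversions P (refl_prod xs)) = Suc (card (inversions P (refl_prod (x # xs))))"
    using inversions_Cons [OF _ assms(2) *] finite_inversions
    by (metis card_insert_disjoint)
qed

lemma card_inversions_le: "set xs \<subseteq> \<Delta> \<Longrightarrow> card (inversions P (refl_prod xs)) \<le> length xs"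
proof (induction xs)
  case (Cons x xs)
  then show ?case using card_inversions_Cons [of xs x]
    by (cases "refl_prod (rev xs) x \<in> P") (simp_all del: refl_prod_simps)
qed (simp add: inversions_def)

text \<open>Minimality is expressed by the inversion count, which can be tracked letter by letter;
  \<open>weyl_length_eq\<close> identifies it with the length.\<close>

definition reduced :: "'a list \<Rightarrow> bool" where
  "reduced xs \<longleftrightarrow> set xs \<subseteq> \<Delta> \<and> card (inversions P (refl_prod xs)) = length xs"

lemma reduced_subset: "reduced xs \<Longrightarrow> set xs \<subseteq> \<Delta>"
  by (simp add: reduced_def)

lemma reduced_Nil: "reduced []"
  by (simp add: reduced_def inversions_def)

text \<open>The count goes up or down by one and never exceeds the length of the word, so a reduced
  word must gain an inversion with every letter.\<close>

lemma reduced_Cons: "reduced (x # xs) \<longleftrightarrow> x \<in> \<Delta> \<and> reduced xs \<and> refl_prod (rev xs) x \<in> P"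
  using card_inversions_Cons [of xs x] card_inversions_le [of xs]
  by (cases "refl_prod (rev xs) x \<in> P") (auto simp: reduced_def simp del: refl_prod_simps)

lemma inversions_rev:
  assumes "set xs \<subseteq> \<Delta>" "\<beta> \<in> inversions P (refl_prod xs)"
  shows "- refl_prod xs \<beta> \<in> inversions P (refl_prod (rev xs))"
proof -
  have "refl_prod xs \<beta> \<in> \<Phi>" "\<beta> \<in> P" using assms word_root pos_root by (auto simp: inversions_def)
  then show ?thesis using assms(2) notin_pos uminus_notin_pos by (auto simp: inversions_def)
qed

lemma card_inversions_rev:
  assumes "set xs \<subseteq> \<Delta>"
  shows "card (inversions P (refl_prod (rev xs))) = card (inversions P (refl_prod xs))"
proof -
  have le: "card (inversions P (refl_prod ys)) \<le> card (inversions P (refl_prod (rev ys)))" if "set ys \<subseteq> \<Delta>" for ys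
  proof (rule card_inj_on_le)
    show "inj_on (\<lambda>\<beta>. - refl_prod ys \<beta>) (inversions P (refl_prod ys))"
      by (rule inj_onI) (metis neg_equal_iff_equal refl_prod_rev(2))
  qed (use inversions_rev that finite_inversions in auto)
  show ?thesis using le [of xs] le [of "rev xs"] assms by simp
qed

lemma reduced_rev [simp]: "reduced (rev xs) \<longleftrightarrow> reduced xs"
  using card_inversions_rev [of xs] by (auto simp: reduced_def)

lemma reduced_appendD2: "reduced (xs @ ys) \<Longrightarrow> reduced ys"
  by (induction xs) (auto simp: reduced_Cons)

lemma reduced_appendD1: "reduced (xs @ ys) \<Longrightarrow> reduced xs"
  using reduced_appendD2 [of "rev ys" "rev xs"] reduced_rev [of "xs @ ys"] by simp

lemma exists_reduced_word:
  assumes "set xs \<subseteq> \<Delta>"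
  shows "\<exists>ys. reduced ys \<and> refl_prod ys = refl_prod xs"
  using assms
proof (induction xs)
  case Nil
  show ?case using reduced_Nil by blast
next
  case (Cons x xs)
  then obtain ys where ys: "reduced ys" "refl_prod ys = refl_prod xs" by auto
  have sub: "set ys \<subseteq> \<Delta>" "x \<in> \<Delta>" using ys Cons reduced_subset by auto
  show ?case
  proof (cases "refl_prod (rev ys) x \<in> P")
    case True
    then show ?thesis using ys sub by (intro exI [of _ "x # ys"]) (simp add: reduced_Cons)
  next
    case False
    \<comment> \<open>Strong exchange multiplies on the right, so it is applied to the inverse word
      \<open>rev ys\<close>.\<close>
    then have "x \<in> inversions P (refl_prod (rev ys))" using sub by (simp add: inversions_def simple_pos)
    then obtain as y bs where ab: "rev ys = as @ y # bs" "refl_prod (rev ys) \<circ> root_refl x = refl_prod (as @ bs)"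
      using strong_exchange [of "rev ys" x] sub by auto
    let ?z = "rev (as @ bs)"
    have "ys = rev (as @ y # bs)" using ab(1) by (metis rev_rev_ident)
    then have len: "length ys = Suc (length ?z)" and zsub: "set ?z \<subseteq> \<Delta>" using sub by auto
    have z: "refl_prod ?z = refl_prod (x # ys)"
    proof
      fix u
      have "refl_prod ?z u = refl_prod ?z ((refl_prod (rev ys) \<circ> root_refl x) (root_refl x (refl_prod ys u)))"
        by (simp del: rev_append)
      also have "\<dots> = root_refl x (refl_prod ys u)"
        unfolding ab(2) by (rule refl_prod_rev(2))
      finally show "refl_prod ?z u = refl_prod (x # ys) u" by simp
    qed
    have "card (inversions P (refl_prod ?z)) = length ?z"
      using card_inversions_Cons(2) [OF sub False] ys(1) len unfolding z reduced_def by simp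
    then have "reduced ?z" using zsub by (simp only: reduced_def simp_thms)
    moreover have "refl_prod ?z = refl_prod (x # xs)" unfolding z using ys(2) by simp
    ultimately show ?thesis by blast
  qed
qed

lemma weyl_length_eq:
  assumes "set xs \<subseteq> \<Delta>"
  shows "weyl_length P (refl_prod xs) = card (inversions P (refl_prod xs))"
  unfolding weyl_length_def
proof (rule Least_equality)
  obtain ys where "reduced ys" "refl_prod ys = refl_prod xs" using exists_reduced_word assms by blast
  then show "\<exists>as. set as \<subseteq> \<Delta> \<and> length as = card (inversions P (refl_prod xs)) \<and> refl_prod xs = refl_prod as"
    by (metis reduced_def)
qed (use card_inversions_le in auto)

lemma weyl_length_le: "set xs \<subseteq> \<Delta> \<Longrightarrow> weyl_length P (refl_prod xs) \<le> length xs"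
  by (simp add: weyl_length_eq card_inversions_le)

lemma weyl_length_reduced: "reduced xs \<Longrightarrow> weyl_length P (refl_prod xs) = length xs"
  by (simp add: weyl_length_eq reduced_def)

lemma weyl_group_reduced_word:
  assumes "w \<in> weyl_group \<Phi>"
  shows "\<exists>xs. reduced xs \<and> w = refl_prod xs"
  using weyl_group_word [OF assms] exists_reduced_word by metis

lemma bruhat_step_subword:
  assumes "set ys \<subseteq> \<Delta>" "bruhat_step \<Phi> P u (refl_prod ys)"
  shows "\<exists>zs. subseq zs ys \<and> u = refl_prod zs"
proof -
  obtain \<alpha> where u: "u \<in> weyl_group \<Phi>" and a: "\<alpha> \<in> \<Phi>" "refl_prod ys = u \<circ> root_refl \<alpha>"
    and less: "weyl_length P u < weyl_length P (refl_prod ys)"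
    using assms(2) by (auto simp: bruhat_step_def)
  obtain \<beta> where b: "\<beta> \<in> P" "refl_prod ys = u \<circ> root_refl \<beta>"
    using a notin_pos [of \<alpha>] root_refl_minus by metis
  then have u_eq: "u = refl_prod ys \<circ> root_refl \<beta>" by (simp add: comp_assoc)
  have "\<beta> \<in> inversions P (refl_prod ys)"
  proof (rule ccontr)
    assume "\<beta> \<notin> inversions P (refl_prod ys)"
    then have "refl_prod ys \<beta> \<in> P" using b by (simp add: inversions_def)
    then have inv: "\<beta> \<in> inversions P u" using b(1) uminus_notin_pos by (simp add: inversions_def u_eq)
    obtain us where us: "reduced us" "u = refl_prod us" using weyl_group_reduced_word u by blast
    then obtain as y bs where ab: "us = as @ y # bs" "refl_prod us \<circ> root_refl \<beta> = refl_prod (as @ bs)"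
      using strong_exchange [of us \<beta>] inv reduced_subset by blast
    have "weyl_length P (refl_prod ys) \<le> length (as @ bs)"
      using weyl_length_le [of "as @ bs"] reduced_subset [OF us(1)] ab b(2) us(2) by simp
    then show False using less weyl_length_reduced [OF us(1)] us(2) ab(1) by simp
  qed
  then obtain as y bs where ab: "ys = as @ y # bs" "refl_prod ys \<circ> root_refl \<beta> = refl_prod (as @ bs)"
    using strong_exchange assms(1) by blast
  then have "subseq (as @ bs) ys" by (auto intro: list_emb_append_mono)
  then show ?thesis using ab u_eq by metis
qed

lemma bruhat_le_subword:
  assumes "bruhat_le \<Phi> P u (refl_prod ys)" "set ys \<subseteq> \<Delta>"
  shows "\<exists>zs. subseq zs ys \<and> u = refl_prod zs"
  using assms(1) unfolding bruhat_le_def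
proof (induction rule: converse_rtranclp_induct)
  case base
  show ?case by blast
next
  case (step u u')
  then obtain zs where zs: "subseq zs ys" "u' = refl_prod zs" by blast
  then have "set zs \<subseteq> \<Delta>" using assms(2) subseq_subset by blast
  then obtain zs' where "subseq zs' zs" "u = refl_prod zs'" using bruhat_step_subword step(1) zs by blast
  then show ?case using zs subseq_order.trans by blast
qed

lemma bruhat_le_refl: "bruhat_le \<Phi> P u u"
  and bruhat_le_trans: "bruhat_le \<Phi> P u x \<Longrightarrow> bruhat_le \<Phi> P x y \<Longrightarrow> bruhat_le \<Phi> P u y"
  by (auto simp: bruhat_le_def)

text \<open>Deleting \<open>y\<close> is right multiplication by the reflection in
  \<open>refl_prod (rev bs) y\<close>; reducedness of the longer word makes the length drop.\<close>

lemma bruhat_step_delete: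
  assumes "reduced (as @ y # bs)"
  shows "bruhat_step \<Phi> P (refl_prod (as @ bs)) (refl_prod (as @ y # bs))"
proof -
  have sub: "set (as @ bs) \<subseteq> \<Delta>" "y \<in> \<Delta>" "set bs \<subseteq> \<Delta>" using reduced_subset [OF assms] by auto
  let ?\<beta> = "refl_prod (rev bs) y"
  have "refl_prod (as @ bs) \<circ> root_refl ?\<beta> = refl_prod (as @ y # bs)"
    using refl_prod_conj [of "rev bs" y, symmetric] by (simp add: fun_eq_iff)
  moreover have "?\<beta> \<in> \<Phi>" using word_root [of "rev bs" y] sub simple_root by simp
  moreover have "weyl_length P (refl_prod (as @ bs)) < weyl_length P (refl_prod (as @ y # bs))"
    using weyl_length_le [OF sub(1)] weyl_length_reduced [OF assms] by simp
  ultimately show ?thesis using word_weyl_group [OF sub(1)] unfolding bruhat_step_def by metis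
qed

lemma bruhat_le_prefix: "reduced (as @ bs) \<Longrightarrow> bruhat_le \<Phi> P (refl_prod as) (refl_prod (as @ bs))"
proof (induction bs rule: rev_induct)
  case Nil
  show ?case using bruhat_le_refl by simp
next
  case (snoc b bs)
  then have "reduced (as @ bs)" using reduced_appendD1 [of "as @ bs" "[b]"] by simp
  moreover have "bruhat_step \<Phi> P (refl_prod (as @ bs)) (refl_prod (as @ bs @ [b]))"
    using bruhat_step_delete [of "as @ bs" b "[]"] snoc.prems by simp
  ultimately show ?case using snoc.IH unfolding bruhat_le_def append_assoc by (metis rtranclp.rtrancl_into_rtrancl)
qed

lemma bruhat_le_id: "reduced xs \<Longrightarrow> bruhat_le \<Phi> P id (refl_prod xs)"
  using bruhat_le_prefix [of "[]" xs] by simp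

end

section \<open>Boolean elements\<close>

text \<open>Lets subwords of a repetition-free word be encoded by subsets of its letters.\<close>

lemma subseq_eq_filter: "subseq zs xs \<Longrightarrow> distinct xs \<Longrightarrow> filter (\<lambda>x. x \<in> set zs) xs = zs"
proof (induction rule: list_emb.induct)
  case (list_emb_Cons xs ys y)
  then show ?case using subseq_subset by auto
next
  case (list_emb_Cons2 x y xs ys)
  then have "filter (\<lambda>z. z \<in> set (x # xs)) ys = filter (\<lambda>z. z \<in> set xs) ys"
    by (intro filter_cong) auto
  then show ?case using list_emb_Cons2 by simp
qed simp

context positive_roots
begin

text \<open>The other letters keep the \<open>x\<close>-coefficient of \<open>x\<close> equal to 1,
  so its image cannot be negative.\<close>

lemma reduced_distinct: "distinct xs \<Longrightarrow> set xs \<subseteq> \<Delta> \<Longrightarrow> reduced xs"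
proof (induction xs)
  case Nil
  show ?case by (rule reduced_Nil)
next
  case (Cons x xs)
  let ?g = "refl_prod (rev xs) x"
  have sub: "set (rev xs) \<subseteq> \<Delta>" "x \<in> \<Delta>" using Cons.prems by auto
  have "coef x ?g = 1" using coef_refl_prod [OF sub(1), of x] coef_simple [OF sub(2)] Cons.prems by simp
  then have "- ?g \<notin> P" using coef_nonneg [of "- ?g" x] by auto
  then have "?g \<in> P" using notin_pos word_root [OF sub(1)] simple_root [OF sub(2)] by blast
  then show ?case using Cons by (simp add: reduced_Cons)
qed

lemma distinct_word_support:
  assumes "distinct ys" "set ys \<subseteq> \<Delta>" "set zs \<subseteq> \<Delta>" "refl_prod ys = refl_prod zs"
  shows "set ys \<subseteq> set zs"
proof (rule subsetI, rule ccontr)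
  fix \<alpha> assume a: "\<alpha> \<in> set ys" "\<alpha> \<notin> set zs"
  then obtain as bs where ys: "ys = as @ \<alpha> # bs" using split_list by metis
  have D: "\<alpha> \<in> \<Delta>" "set as \<subseteq> \<Delta>" "set (rev bs) \<subseteq> \<Delta>" and n: "\<alpha> \<notin> set as" "\<alpha> \<notin> set (rev bs)"
    using assms ys by auto
  \<comment> \<open>A test vector: \<open>bs\<close> brings it back to \<open>\<alpha>\<close>, so
    under \<open>ys\<close> its \<open>\<alpha>\<close>-coefficient becomes -1, whereas a word
    without \<open>\<alpha>\<close> keeps it at 1.\<close>
  let ?x = "refl_prod (rev bs) \<alpha>"
  have "coef \<alpha> (refl_prod ys ?x) = -1"
    using coef_refl_prod [OF D(2) n(1), of "- \<alpha>"] coef_simple [OF D(1)] by (simp add: ys)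
  moreover have "coef \<alpha> (refl_prod zs ?x) = 1"
    using coef_refl_prod [OF assms(3) a(2)] coef_refl_prod [OF D(3) n(2)] coef_simple [OF D(1)] by simp
  ultimately show False using assms(4) by simp
qed

definition subword_prod :: "'a list \<Rightarrow> 'a set \<Rightarrow> 'a \<Rightarrow> 'a" where
  "subword_prod xs S = refl_prod (filter (\<lambda>x. x \<in> S) xs)"

lemma subword_prod_mono:
  assumes "distinct xs" "set xs \<subseteq> \<Delta>" "T \<subseteq> S" "S \<subseteq> set xs"
  shows "bruhat_le \<Phi> P (subword_prod xs T) (subword_prod xs S)"
proof -
  \<comment> \<open>The letters of \<open>F\<close> are inserted one at a time; every intermediate
    word is repetition-free, hence reduced.\<close>
  have "finite F \<Longrightarrow> F \<subseteq> set xs \<Longrightarrow> bruhat_le \<Phi> P (subword_prod xs T) (subword_prod xs (T \<union> F))" for F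
  proof (induction F rule: finite_induct)
    case empty
    show ?case using bruhat_le_refl by simp
  next
    case (insert y F)
    show ?case
    proof (cases "y \<in> T")
      case True
      then show ?thesis using insert by (simp add: insert_absorb)
    next
      case False
      obtain as bs where xs: "xs = as @ y # bs" using insert.prems split_list [of y xs] by blast
      let ?f = "filter (\<lambda>x. x \<in> T \<union> F)" and ?g = "filter (\<lambda>x. x \<in> insert y (T \<union> F))"
      have y: "y \<notin> set as" "y \<notin> set bs" using assms(1) xs by auto
      have "?f xs = ?f as @ ?f bs" using False insert.hyps by (simp add: xs)
      moreover have "?g as = ?f as" "?g bs = ?f bs" using y by (auto intro: filter_cong)
      then have g: "?g xs = ?f as @ y # ?f bs" by (simp add: xs)
      moreover have "reduced (?g xs)"
        by (rule reduced_distinct) (use assms in auto)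
      ultimately have "bruhat_step \<Phi> P (subword_prod xs (T \<union> F)) (subword_prod xs (insert y (T \<union> F)))"
        using bruhat_step_delete unfolding subword_prod_def by metis
      then show ?thesis using insert unfolding bruhat_le_def
        by (metis Un_insert_right insert_subset rtranclp.rtrancl_into_rtrancl)
    qed
  qed
  from this [of S] show ?thesis using assms by (metis Un_absorb1 finite_set finite_subset)
qed

lemma bruhat_le_subword_prod_iff:
  assumes "distinct xs" "set xs \<subseteq> \<Delta>" "T \<subseteq> set xs" "S \<subseteq> set xs"
  shows "bruhat_le \<Phi> P (subword_prod xs T) (subword_prod xs S) \<longleftrightarrow> T \<subseteq> S"
proof
  assume "bruhat_le \<Phi> P (subword_prod xs T) (subword_prod xs S)"
  then obtain zs where zs: "subseq zs (filter (\<lambda>x. x \<in> S) xs)" "subword_prod xs T = refl_prod zs"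
    using bruhat_le_subword [of _ "filter (\<lambda>x. x \<in> S) xs"] assms(2) unfolding subword_prod_def by fastforce
  then have z: "set zs \<subseteq> S" "set zs \<subseteq> \<Delta>" using subseq_subset [OF zs(1)] assms by auto
  have "set (filter (\<lambda>x. x \<in> T) xs) \<subseteq> set zs"
    by (rule distinct_word_support) (use assms z zs(2) in \<open>auto simp: subword_prod_def\<close>)
  then show "T \<subseteq> S" using z(1) assms(3) by auto
qed (use subword_prod_mono assms in auto)

lemma bruhat_interval_distinct:
  assumes "distinct xs" "set xs \<subseteq> \<Delta>"
  shows "bruhat_interval \<Phi> P id (refl_prod xs) = subword_prod xs ` Pow (set xs)"
proof
  have xs: "subword_prod xs (set xs) = refl_prod xs" by (simp add: subword_prod_def)
  show "bruhat_interval \<Phi> P id (refl_prod xs) \<subseteq> subword_prod xs ` Pow (set xs)"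
  proof
    fix x assume "x \<in> bruhat_interval \<Phi> P id (refl_prod xs)"
    then obtain zs where zs: "subseq zs xs" "x = refl_prod zs"
      using bruhat_le_subword assms by (auto simp: bruhat_interval_def)
    then have "x = subword_prod xs (set zs)" using subseq_eq_filter [OF zs(1) assms(1)] zs(2) by (simp add: subword_prod_def)
    then show "x \<in> subword_prod xs ` Pow (set xs)" using subseq_subset [OF zs(1)] by blast
  qed
  show "subword_prod xs ` Pow (set xs) \<subseteq> bruhat_interval \<Phi> P id (refl_prod xs)"
  proof
    fix x assume "x \<in> subword_prod xs ` Pow (set xs)"
    then obtain S where S: "S \<subseteq> set xs" "x = subword_prod xs S" by blast
    have "reduced (filter (\<lambda>x. x \<in> S) xs)" by (rule reduced_distinct) (use assms in auto)
    then have "x \<in> weyl_group \<Phi>" "bruhat_le \<Phi> P id x"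
      using S bruhat_le_id word_weyl_group reduced_subset unfolding subword_prod_def by blast+
    moreover have "bruhat_le \<Phi> P x (refl_prod xs)"
      using subword_prod_mono [OF assms S(1)] S xs by simp
    ultimately show "x \<in> bruhat_interval \<Phi> P id (refl_prod xs)" by (simp add: bruhat_interval_def)
  qed
qed

lemma boolean_distinct:
  assumes "distinct xs" "set xs \<subseteq> \<Delta>"
  shows "boolean_element \<Phi> P (refl_prod xs)"
proof -
  let ?g = "subword_prod xs" and ?I = "bruhat_interval \<Phi> P id (refl_prod xs)"
  have "inj_on ?g (Pow (set xs))"
  proof (rule inj_onI)
    fix S T assume "S \<in> Pow (set xs)" "T \<in> Pow (set xs)" "?g S = ?g T"
    then show "S = T" using bruhat_le_subword_prod_iff [OF assms] bruhat_le_refl by (metis Pow_iff subset_antisym)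
  qed
  then have g: "bij_betw ?g (Pow (set xs)) ?I"
    using bruhat_interval_distinct [OF assms] by (simp add: bij_betw_def)
  \<comment> \<open>Numbers the letters, since the model lattice consists of subsets of an initial
    segment of the naturals.\<close>
  obtain h where h: "bij_betw h (set xs) {..<card (set xs)}"
    using ex_bij_betw_finite_nat [of "set xs"] by (auto simp: atLeast0LessThan)
  let ?k = "inv_into (Pow (set xs)) ?g"
  let ?f = "image h \<circ> ?k"
  have k: "bij_betw ?k ?I (Pow (set xs))" using g by (rule bij_betw_inv_into)
  have "bij_betw ?f ?I (Pow {..<card (set xs)})"
    using k bij_betw_Pow [OF h] by (rule bij_betw_trans)
  moreover have "bruhat_le \<Phi> P x y \<longleftrightarrow> ?f x \<subseteq> ?f y" if "x \<in> ?I" "y \<in> ?I" for x y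
  proof -
    have S: "?k x \<subseteq> set xs" "?k y \<subseteq> set xs" using k that by (auto dest: bij_betwE)
    have "x = ?g (?k x)" "y = ?g (?k y)" using g that by (simp_all add: bij_betw_inv_into_right)
    then have "bruhat_le \<Phi> P x y \<longleftrightarrow> ?k x \<subseteq> ?k y"
      using bruhat_le_subword_prod_iff [OF assms S] by simp
    also have "\<dots> \<longleftrightarrow> ?f x \<subseteq> ?f y"
    proof
      assume "?f x \<subseteq> ?f y"
      then show "?k x \<subseteq> ?k y"
        using S h unfolding bij_betw_def inj_on_def by (simp add: image_subset_iff) blast
    qed auto
    finally show ?thesis .
  qed
  ultimately show ?thesis unfolding boolean_element_def by blast
qed

lemma boolean_imp_distinct:
  assumes red: "reduced xs" and "boolean_element \<Phi> P (refl_prod xs)"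
  shows "distinct xs"
proof -
  let ?I = "bruhat_interval \<Phi> P id (refl_prod xs)"
  obtain n :: nat and f where f: "bij_betw f ?I (Pow {..<n})"
    and le: "\<And>x y. x \<in> ?I \<Longrightarrow> y \<in> ?I \<Longrightarrow> bruhat_le \<Phi> P x y \<longleftrightarrow> f x \<subseteq> f y"
    using assms(2) by (auto simp: boolean_element_def)
  have inj: "inj_on f ?I" and fI: "f ` ?I = Pow {..<n}" using f by (auto simp: bij_betw_def)
  have sub: "f x \<subseteq> {..<n}" if "x \<in> ?I" for x
    using imageI [OF that, of f] unfolding fI by simp
  have wI: "x \<in> ?I" if "x \<in> weyl_group \<Phi>" "bruhat_le \<Phi> P x (refl_prod xs)" for x
    using that weyl_group_reduced_word bruhat_le_id by (auto simp: bruhat_interval_def)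
  have prefix: "refl_prod (take i xs) \<in> ?I" for i
    using bruhat_le_prefix [of "take i xs" "drop i xs"] red wI word_weyl_group
      reduced_subset [OF reduced_appendD1, of "take i xs" "drop i xs"] by simp
  have chain: "i \<le> length xs \<Longrightarrow> i \<le> card (f (refl_prod (take i xs)))" for i
  proof (induction i)
    case (Suc i)
    let ?x = "refl_prod (take i xs)" and ?y = "refl_prod (take (Suc i) xs)"
    have t: "take (Suc i) xs = take i xs @ [xs ! i]" using Suc.prems by (simp add: take_Suc_conv_app_nth)
    have ry: "reduced (take (Suc i) xs)"
      using reduced_appendD1 [of "take (Suc i) xs" "drop (Suc i) xs"] red by simp
    have step: "bruhat_step \<Phi> P ?x ?y"
      using bruhat_step_delete [of "take i xs" "xs ! i" "[]"] ry
      by (simp add: t del: refl_prod_simps refl_prod_append)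
    then have "weyl_length P ?x < weyl_length P ?y" unfolding bruhat_step_def by blast
    then have "?x \<noteq> ?y" by (metis less_irrefl)
    then have "f ?x \<noteq> f ?y" using inj prefix by (meson inj_onD)
    moreover have "f ?x \<subseteq> f ?y" using le prefix step unfolding bruhat_le_def by (meson r_into_rtranclp)
    moreover have "finite (f ?y)" using sub [OF prefix] by (rule finite_subset) simp
    ultimately have "card (f ?x) < card (f ?y)" by (meson psubsetI psubset_card_mono)
    then show ?case using Suc by simp
  qed simp
  have "f (refl_prod xs) \<subseteq> {..<n}" using sub [OF prefix [of "length xs"]] by simp
  then have "length xs \<le> n" using chain [of "length xs"] card_mono [of "{..<n}" "f (refl_prod xs)"] by simp
  \<comment> \<open>Let \<open>a\<close> be the atom mapped to \<open>{k}\<close>. The first letter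
    of a reduced word of \<open>a\<close> lies below \<open>a\<close> and differs from
    \<open>id\<close>, so it is mapped to \<open>{k}\<close> too; the subword property finds it in
    \<open>xs\<close>.\<close>
  have "\<exists>y. y \<in> set xs \<and> refl_prod [y] \<in> ?I \<and> f (refl_prod [y]) = {k}" if "k < n" for k
  proof -
    have "{k} \<in> f ` ?I" "{} \<in> f ` ?I" using that unfolding fI by auto
    then obtain a e where a: "a \<in> ?I" "f a = {k}" and e: "e \<in> ?I" "f e = {}" by (metis (no_types) imageE)
    have idI: "id \<in> ?I" using prefix [of 0] by simp
    have id0: "f id = {}" using le [OF idI e(1)] e by (auto simp: bruhat_interval_def)
    obtain ys where ys: "reduced ys" "a = refl_prod ys"
      using weyl_group_reduced_word a(1) by (auto simp: bruhat_interval_def)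
    have "ys \<noteq> []" using ys(2) a id0 by auto
    then obtain y ys' where y: "ys = [y] @ ys'" by (cases ys) auto
    have yr: "reduced [y]" using ys(1) reduced_appendD1 unfolding y by blast
    have ya: "bruhat_le \<Phi> P (refl_prod [y]) a" using bruhat_le_prefix ys unfolding y by blast
    then have yle: "bruhat_le \<Phi> P (refl_prod [y]) (refl_prod xs)"
      using a(1) bruhat_le_trans by (auto simp: bruhat_interval_def)
    then have yI: "refl_prod [y] \<in> ?I" using wI word_weyl_group reduced_subset [OF yr] by blast
    have "refl_prod [y] \<noteq> id"
      using weyl_length_reduced [OF yr] weyl_length_reduced [OF reduced_Nil] by auto
    then have "f (refl_prod [y]) \<noteq> {}" using inj yI idI id0 by (metis inj_onD)
    moreover have "f (refl_prod [y]) \<subseteq> {k}" using le [OF yI a(1)] ya a(2) by simp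
    ultimately have fy: "f (refl_prod [y]) = {k}" by blast
    obtain zs where zs: "subseq zs xs" "refl_prod [y] = refl_prod zs"
      using bruhat_le_subword [OF yle reduced_subset [OF red]] by blast
    have "set [y] \<subseteq> set zs"
      by (rule distinct_word_support)
         (use zs subseq_subset [OF zs(1)] reduced_subset [OF red] reduced_subset [OF yr] in auto)
    then show ?thesis using yI fy subseq_subset [OF zs(1)] by auto
  qed
  then obtain y where y: "\<And>k. k < n \<Longrightarrow> y k \<in> set xs \<and> f (refl_prod [y k]) = {k}" by metis
  have "inj_on y {..<n}"
    by (rule inj_onI) (metis lessThan_iff singleton_inject y)
  then have "n \<le> card (set xs)" using card_inj_on_le [of y "{..<n}" "set xs"] y by auto
  then show ?thesis using \<open>length xs \<le> n\<close> card_length [of xs] by (simp add: card_distinct)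
qed

lemma boolean_iff_distinct: "reduced xs \<Longrightarrow> boolean_element \<Phi> P (refl_prod xs) \<longleftrightarrow> distinct xs"
  using boolean_distinct boolean_imp_distinct reduced_subset by blast

end

section \<open>Patterns in terms of positive roots\<close>

text \<open>Here \<open>a, b, c, d\<close> are the images of the simple roots \<open>\<alpha>\<^sub>1, \<alpha>\<^sub>2, \<alpha>\<^sub>3, \<alpha>\<^sub>4\<close> under the linear map.\<close>

definition pattern_A2 :: "'a::euclidean_space set \<Rightarrow> ('a \<Rightarrow> 'a) \<Rightarrow> bool" where
  "pattern_A2 P w \<longleftrightarrow> (\<exists>a b. {a, b, a + b} \<subseteq> inversions P w)"

definition pattern_A3 :: "'a::euclidean_space set \<Rightarrow> ('a \<Rightarrow> 'a) \<Rightarrow> bool" where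
  "pattern_A3 P w \<longleftrightarrow> (\<exists>a b c. {a, c} \<subseteq> P - inversions P w \<and>
     {b, a + b, b + c, a + b + c} \<subseteq> inversions P w)"

definition pattern_D4 :: "'a::euclidean_space set \<Rightarrow> ('a \<Rightarrow> 'a) \<Rightarrow> bool" where
  "pattern_D4 P w \<longleftrightarrow> (\<exists>a b c d.
     {a, c, d, a + b + c, a + b + d, b + c + d, a + b + c + d} \<subseteq> P - inversions P w \<and>
     {b, a + b, b + c, b + d, a + b + b + c + d} \<subseteq> inversions P w)"

text \<open>Only \<open>P\<close> and the inversion set enter. Repeated roots are allowed,
  reflecting that the linear map may fail to be injective.\<close>

definition has_pattern :: "'a::euclidean_space set \<Rightarrow> ('a \<Rightarrow> 'a) \<Rightarrow> bool" where
  "has_pattern P w \<longleftrightarrow> pattern_A2 P w \<or> pattern_A3 P w \<or> pattern_D4 P w"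

lemma has_pattern_A2: "a \<in> inversions P w \<Longrightarrow> b \<in> inversions P w \<Longrightarrow> a + b \<in> inversions P w \<Longrightarrow> has_pattern P w"
  unfolding has_pattern_def pattern_A2_def by (intro disjI1 exI [of _ a] exI [of _ b]) simp

lemma has_pattern_A3:
  "{a, c} \<subseteq> P - inversions P w \<Longrightarrow> {b, a + b, b + c, a + b + c} \<subseteq> inversions P w \<Longrightarrow> has_pattern P w"
  unfolding has_pattern_def pattern_A3_def
  by (intro disjI2 [OF disjI1] exI [of _ a] exI [of _ b] exI [of _ c] conjI)

lemma has_pattern_D4:
  "{a, c, d, a + b + c, a + b + d, b + c + d, a + b + c + d} \<subseteq> P - inversions P w \<Longrightarrow>
   {b, a + b, b + c, b + d, a + b + b + c + d} \<subseteq> inversions P w \<Longrightarrow> has_pattern P w"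
  unfolding has_pattern_def pattern_D4_def
  by (intro disjI2 [OF disjI2] exI [of _ a] exI [of _ b] exI [of _ c] exI [of _ d] conjI)

text \<open>If a non-inversion of an embedded \<open>A\<^sub>3\<close> or \<open>D\<^sub>4\<close> pattern becomes an inversion, then it forms
  an \<open>A\<^sub>2\<close> pattern with one of the other inversions.\<close>

lemma has_pattern_mono:
  assumes "inversions P w \<subseteq> inversions P w'" "has_pattern P w"
  shows "has_pattern P w'"
proof (rule ccontr)
  let ?I = "inversions P w'"
  assume no: "\<not> has_pattern P w'"
  have A2: "a \<notin> ?I" if "b \<in> ?I" "c \<in> ?I" "a + b = c" for a b c
    using that no has_pattern_A2 by metis
  consider "pattern_A2 P w" | "pattern_A3 P w" | "pattern_D4 P w" using assms(2) by (auto simp: has_pattern_def)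
  then show False
  proof cases
    case 1
    then obtain a b where "{a, b, a + b} \<subseteq> inversions P w" unfolding pattern_A2_def by blast
    then have "a \<in> ?I" "b \<in> ?I" "a + b \<in> ?I" using assms(1) by auto
    then have "has_pattern P w'" by (rule has_pattern_A2)
    then show False using no by simp
  next
    case 2
    then obtain a b c where pos: "{a, c} \<subseteq> P - inversions P w"
      and "{b, a + b, b + c, a + b + c} \<subseteq> inversions P w" unfolding pattern_A3_def by blast
    then have inv: "{b, a + b, b + c, a + b + c} \<subseteq> ?I" using assms(1) by (meson order_trans)
    have "a \<notin> ?I" by (rule A2 [of b "a + b"]) (use inv in simp_all)
    moreover have "c \<notin> ?I" by (rule A2 [of b "b + c"]) (use inv in simp_all)
    ultimately have "{a, c} \<subseteq> P - ?I" using pos by blast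
    then have "has_pattern P w'" using inv by (rule has_pattern_A3)
    then show False using no by simp
  next
    case 3
    then obtain a b c d where pos: "{a, c, d, a + b + c, a + b + d, b + c + d, a + b + c + d} \<subseteq> P - inversions P w"
      and "{b, a + b, b + c, b + d, a + b + b + c + d} \<subseteq> inversions P w" unfolding pattern_D4_def by (elim exE conjE) (rule that)
    then have inv: "{b, a + b, b + c, b + d, a + b + b + c + d} \<subseteq> ?I" using assms(1) by (meson order_trans)
    have "a \<notin> ?I" by (rule A2 [of b "a + b"]) (use inv in simp_all)
    moreover have "c \<notin> ?I" by (rule A2 [of b "b + c"]) (use inv in simp_all)
    moreover have "d \<notin> ?I" by (rule A2 [of b "b + d"]) (use inv in simp_all)
    moreover have "a + b + c \<notin> ?I" by (rule A2 [of "b + d" "a + b + b + c + d"]) (use inv in simp_all)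
    moreover have "a + b + d \<notin> ?I" by (rule A2 [of "b + c" "a + b + b + c + d"]) (use inv in simp_all)
    moreover have "b + c + d \<notin> ?I" by (rule A2 [of "a + b" "a + b + b + c + d"]) (use inv in simp_all)
    moreover have "a + b + c + d \<notin> ?I" by (rule A2 [of b "a + b + b + c + d"]) (use inv in simp_all)
    ultimately have "{a, c, d, a + b + c, a + b + d, b + c + d, a + b + c + d} \<subseteq> P - ?I" using pos by blast
    then have "has_pattern P w'" using inv by (rule has_pattern_D4)
    then show False using no by simp
  qed
qed

context positive_roots
begin

lemma noninversions_rev:
  assumes "\<beta> \<in> P - inversions P (refl_prod xs)"
  shows "refl_prod xs \<beta> \<in> P - inversions P (refl_prod (rev xs))"
  using assms by (auto simp: inversions_def)

text \<open>The three patterns are involutions. If \<open>f\<close> is a pattern map for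
  \<open>w\<close> and \<open>p\<close> the pattern, then \<open>w \<circ> f \<circ> p\<close> is a
  pattern map for the inverse of \<open>w\<close>; the witnesses are its values on the simple roots,
  up to the diagram flip in types A_2 and A_3.\<close>

lemma has_pattern_rev:
  assumes sub: "set xs \<subseteq> \<Delta>" and "has_pattern P (refl_prod xs)"
  shows "has_pattern P (refl_prod (rev xs))"
proof -
  let ?w = "refl_prod xs" and ?I = "inversions P (refl_prod xs)" and ?J = "inversions P (refl_prod (rev xs))"
  have I: "- ?w \<beta> \<in> ?J" if "\<beta> \<in> ?I" for \<beta> using inversions_rev [OF sub that] .
  have N: "?w \<beta> \<in> P - ?J" if "\<beta> \<in> P - ?I" for \<beta> using noninversions_rev [OF that] .
  consider "pattern_A2 P ?w" | "pattern_A3 P ?w" | "pattern_D4 P ?w" using assms(2) by (auto simp: has_pattern_def)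
  then show ?thesis
  proof cases
    case 1
    then obtain a b where *: "{a, b, a + b} \<subseteq> ?I" unfolding pattern_A2_def by blast
    have eq: "- ?w a + - ?w b = - ?w (a + b)" by simp
    have "- ?w a + - ?w b \<in> ?J" unfolding eq by (rule I) (use * in blast)
    moreover have "- ?w a \<in> ?J" "- ?w b \<in> ?J" using * I by simp_all
    ultimately show ?thesis using has_pattern_A2 by metis
  next
    case 2
    then obtain a b c where *: "{a, c} \<subseteq> P - ?I" "{b, a + b, b + c, a + b + c} \<subseteq> ?I"
      unfolding pattern_A3_def by blast
    let ?a = "?w a" and ?c = "?w c" and ?b = "- ?w (a + b + c)"
    have "{?a, ?c} \<subseteq> P - ?J" using *(1) N by blast
    moreover have "?a + ?b = - ?w (b + c)" "?b + ?c = - ?w (a + b)" "?a + ?b + ?c = - ?w b" by simp_all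
    then have "{?b, ?a + ?b, ?b + ?c, ?a + ?b + ?c} \<subseteq> ?J" using *(2) I by (simp only: insert_subset empty_subsetI simp_thms)
    ultimately show ?thesis by (rule has_pattern_A3)
  next
    case 3
    then obtain a b c d where *: "{a, c, d, a + b + c, a + b + d, b + c + d, a + b + c + d} \<subseteq> P - ?I"
      "{b, a + b, b + c, b + d, a + b + b + c + d} \<subseteq> ?I" unfolding pattern_D4_def by (elim exE conjE) (rule that)
    let ?a = "?w (b + c + d)" and ?c = "?w (a + b + d)" and ?d = "?w (a + b + c)" and ?b = "- ?w (a + b + b + c + d)"
    have "?a + ?b + ?c = ?w d" "?a + ?b + ?d = ?w c" "?b + ?c + ?d = ?w a"
      "?a + ?b + ?c + ?d = ?w (a + b + c + d)" by simp_all
    then have "{?a, ?c, ?d, ?a + ?b + ?c, ?a + ?b + ?d, ?b + ?c + ?d, ?a + ?b + ?c + ?d} \<subseteq> P - ?J"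
      using *(1) N by (simp only: insert_subset empty_subsetI simp_thms)
    moreover have "?a + ?b = - ?w (a + b)" "?b + ?c = - ?w (b + c)" "?b + ?d = - ?w (b + d)"
      "?a + ?b + ?b + ?c + ?d = - ?w b" by simp_all
    then have "{?b, ?a + ?b, ?b + ?c, ?b + ?d, ?a + ?b + ?b + ?c + ?d} \<subseteq> ?J"
      using *(2) I by (simp only: insert_subset empty_subsetI simp_thms)
    ultimately show ?thesis by (rule has_pattern_D4)
  qed
qed

lemma has_pattern_Cons:
  assumes "reduced (x # xs)" "has_pattern P (refl_prod xs)"
  shows "has_pattern P (refl_prod (x # xs))"
proof -
  have x: "x \<in> \<Delta>" "set xs \<subseteq> \<Delta>" "refl_prod (rev xs) x \<in> P"
    using assms(1) by (auto simp: reduced_Cons dest: reduced_subset)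
  show ?thesis
    by (rule has_pattern_mono [OF _ assms(2)]) (use inversions_Cons(1) [OF x(2,1,3)] in blast)
qed

text \<open>A new last letter also reflects the old inversions instead of just enlarging their set,
  so the word is reversed, extended on the left and reversed back.\<close>

lemma has_pattern_snoc:
  assumes "reduced (xs @ [x])" "has_pattern P (refl_prod xs)"
  shows "has_pattern P (refl_prod (xs @ [x]))"
proof -
  have sub: "set (xs @ [x]) \<subseteq> \<Delta>" and red: "reduced (x # rev xs)"
    using assms(1) reduced_subset [OF assms(1)] reduced_rev [of "xs @ [x]"] by simp_all
  have "has_pattern P (refl_prod (rev xs))" using has_pattern_rev assms(2) sub by simp
  then have "has_pattern P (refl_prod (x # rev xs))" by (rule has_pattern_Cons [OF red])
  then show ?thesis using has_pattern_rev [of "x # rev xs"] sub by simp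
qed

text \<open>Both \<open>\<beta>\<close> and \<open>- refl_prod xs \<beta>\<close> are positive, yet
  their \<open>\<alpha>\<close>-coefficients are opposite.\<close>

lemma coef_inversion:
  assumes "set xs \<subseteq> \<Delta>" "\<alpha> \<notin> set xs" "\<beta> \<in> inversions P (refl_prod xs)"
  shows "coef \<alpha> \<beta> = 0"
proof -
  have b: "\<beta> \<in> P" "refl_prod xs \<beta> \<notin> P" using assms(3) by (auto simp: inversions_def)
  then have "- refl_prod xs \<beta> \<in> P" using notin_pos word_root [OF assms(1)] pos_root by blast
  then have "coef \<alpha> (- refl_prod xs \<beta>) \<ge> 0" by (rule coef_nonneg)
  then show ?thesis using coef_nonneg [OF b(1), of \<alpha>] coef_refl_prod [OF assms(1,2), of \<beta>] by simp
qed

lemma sum_notin_simple: "\<beta> \<in> P \<Longrightarrow> \<gamma> \<in> P \<Longrightarrow> \<beta> + \<gamma> \<notin> \<Delta>"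
  unfolding simple_roots_def by blast

text \<open>The reflection in \<open>\<alpha>\<close> transports the pattern once
  \<open>\<alpha>\<close> is not among its roots. Sums of positive roots are not simple, so only the
  images of simple roots are in question; for those that are inversions, the linear relations
  between the values \<open>?c\<close> exclude \<open>?c \<alpha> = -1\<close>.\<close>

lemma has_pattern_new_letter:
  assumes sub: "set xs \<subseteq> \<Delta>" and a: "\<alpha> \<in> \<Delta>" and new: "\<alpha> \<notin> set xs"
    and pat: "has_pattern P (refl_prod (xs @ [\<alpha>]))"
  shows "has_pattern P (refl_prod xs)"
proof -
  let ?s = "root_refl \<alpha>" and ?I = "inversions P (refl_prod (xs @ [\<alpha>]))" and ?J = "inversions P (refl_prod xs)"
  let ?c = "\<lambda>\<beta>. coef \<alpha> (?s \<beta>)"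
  have IP: "\<beta> \<in> P" if "\<beta> \<in> ?I" for \<beta> using that by (simp add: inversions_def)
  have I: "?s \<beta> \<in> ?J" if "\<beta> \<in> ?I" "\<beta> \<noteq> \<alpha>" for \<beta>
    using that simple_refl_pos a by (auto simp: inversions_def)
  have c0: "?c \<beta> = 0" if "\<beta> \<in> ?I" "\<beta> \<noteq> \<alpha>" for \<beta>
    using coef_inversion [OF sub new I [OF that]] .
  have "coef \<alpha> (refl_prod xs \<alpha>) = 1" using coef_refl_prod [OF sub new] coef_simple [OF a] by simp
  then have "refl_prod (xs @ [\<alpha>]) \<alpha> \<notin> P" using coef_nonneg [of "- refl_prod xs \<alpha>" \<alpha>] by auto
  then have "\<alpha> \<in> ?I" using a by (simp add: inversions_def simple_pos)
  then have N: "?s \<beta> \<in> P - ?J" if "\<beta> \<in> P - ?I" for \<beta>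
  proof -
    have "\<beta> \<noteq> \<alpha>" using that \<open>\<alpha> \<in> ?I\<close> by blast
    then show ?thesis using that simple_refl_pos [OF a, of \<beta>] by (auto simp: inversions_def)
  qed
  have ca: "?c \<alpha> = -1" using coef_simple [OF a] by simp
  have ne: "\<beta> + \<gamma> \<noteq> \<alpha>" if "\<beta> \<in> P" "\<gamma> \<in> P" for \<beta> \<gamma> using sum_notin_simple that a by blast
  consider "pattern_A2 P (refl_prod (xs @ [\<alpha>]))" | "pattern_A3 P (refl_prod (xs @ [\<alpha>]))"
    | "pattern_D4 P (refl_prod (xs @ [\<alpha>]))" using pat by (auto simp: has_pattern_def)
  then show ?thesis
  proof cases
    case 1
    then obtain p q where *: "{p, q, p + q} \<subseteq> ?I" unfolding pattern_A2_def by blast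
    then have ne': "p + q \<noteq> \<alpha>" using ne IP by blast
    then have "?c p + ?c q = 0" using c0 [of "p + q"] * by simp
    moreover have "?c p \<le> 0" "?c q \<le> 0"
      using c0 [of p] c0 [of q] ca * by (cases "p = \<alpha>"; cases "q = \<alpha>"; simp)+
    ultimately have "p \<noteq> \<alpha>" "q \<noteq> \<alpha>" using ca by auto
    then have "?s p \<in> ?J" "?s q \<in> ?J" "?s (p + q) \<in> ?J" using I ne' * by blast+
    then show ?thesis using has_pattern_A2 by simp
  next
    case 2
    then obtain p q r where *: "{p, r} \<subseteq> P - ?I" "{q, p + q, q + r, p + q + r} \<subseteq> ?I"
      unfolding pattern_A3_def by blast
    then have P: "{p, q, r, p + q} \<subseteq> P" using IP by blast
    then have n: "p + q \<noteq> \<alpha>" "q + r \<noteq> \<alpha>" "p + q + r \<noteq> \<alpha>" using ne by blast+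
    then have "?c p + ?c q = 0" "?c q + ?c r = 0" "?c p + ?c q + ?c r = 0"
      using c0 [of "p + q"] c0 [of "q + r"] c0 [of "p + q + r"] * by simp_all
    then have "q \<noteq> \<alpha>" using ca by auto
    then have "{?s q, ?s (p + q), ?s (q + r), ?s (p + q + r)} \<subseteq> ?J" using I n *(2) by blast
    moreover have "{?s p, ?s r} \<subseteq> P - ?J" using N *(1) by blast
    ultimately show ?thesis
      by (intro has_pattern_A3 [where a = "?s p" and b = "?s q" and c = "?s r"]) simp_all
  next
    case 3
    then obtain p q r t where *: "{p, r, t, p + q + r, p + q + t, q + r + t, p + q + r + t} \<subseteq> P - ?I"
      "{q, p + q, q + r, q + t, p + q + q + r + t} \<subseteq> ?I" unfolding pattern_D4_def by (elim exE conjE) (rule that)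
    then have P: "{p, q, r, t, p + q + r, q + t} \<subseteq> P" using IP by blast
    have eq: "p + q + q + r + t = (p + q + r) + (q + t)" by simp
    have n: "p + q \<noteq> \<alpha>" "q + r \<noteq> \<alpha>" "q + t \<noteq> \<alpha>" "p + q + q + r + t \<noteq> \<alpha>"
      using P ne unfolding eq by blast+
    \<comment> \<open>The values at \<open>p\<close>, \<open>r\<close>, \<open>t\<close> are all
      \<open>- ?c q\<close>, so the last relation reduces to \<open>?c q = 0\<close>.\<close>
    then have "?c p + ?c q = 0" "?c q + ?c r = 0" "?c q + ?c t = 0" "?c p + ?c q + ?c q + ?c r + ?c t = 0"
      using c0 [of "p + q"] c0 [of "q + r"] c0 [of "q + t"] c0 [of "p + q + q + r + t"] * by simp_all
    then have "q \<noteq> \<alpha>" using ca by auto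
    then have "{?s q, ?s (p + q), ?s (q + r), ?s (q + t), ?s (p + q + q + r + t)} \<subseteq> ?J" using I n *(2) by blast
    moreover have "{?s p, ?s r, ?s t, ?s (p + q + r), ?s (p + q + t), ?s (q + r + t), ?s (p + q + r + t)} \<subseteq> P - ?J"
      using N *(1) by blast
    ultimately show ?thesis
      by (intro has_pattern_D4 [where a = "?s p" and b = "?s q" and c = "?s r" and d = "?s t"]) simp_all
  qed
qed

lemma distinct_no_pattern: "distinct xs \<Longrightarrow> set xs \<subseteq> \<Delta> \<Longrightarrow> \<not> has_pattern P (refl_prod xs)"
proof (induction xs rule: rev_induct)
  case Nil
  show ?case
    by (simp add: has_pattern_def pattern_A2_def pattern_A3_def pattern_D4_def inversions_def)
next
  case (snoc x xs)
  then have "distinct xs" "set xs \<subseteq> \<Delta>" "x \<in> \<Delta>" "x \<notin> set xs" by auto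
  then show ?case using has_pattern_new_letter [of xs x] snoc.IH by blast
qed

end

section \<open>Neighbours of a simple root\<close>

context positive_roots
begin

lemma inversionI: "\<beta> \<in> \<Phi> \<Longrightarrow> v \<bullet> \<beta> > 0 \<Longrightarrow> v \<bullet> w \<beta> < 0 \<Longrightarrow> \<beta> \<in> inversions P w"
  by (simp add: P_eq inversions_def)

lemma noninversionI:
  assumes "set xs \<subseteq> \<Delta>" "\<beta> \<in> \<Phi>" "v \<bullet> \<beta> > 0" "v \<bullet> refl_prod xs \<beta> > 0"
  shows "\<beta> \<in> P - inversions P (refl_prod xs)"
  using assms word_root [OF assms(1,2)] by (simp add: P_eq inversions_def)

text \<open>The equations say that the word acts on \<open>a\<close>, \<open>b\<close>,
  \<open>c\<close> as the pattern acts on its own simple roots; all signs then follow by linearity.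
  Both \<open>a = c\<close> and non-simple roots occur in the applications.\<close>

lemma has_pattern_A3I:
  assumes "set xs \<subseteq> \<Delta>" "{a, b, c, a + b, b + c, a + b + c} \<subseteq> \<Phi>"
    and "v \<bullet> a > 0" "v \<bullet> b > 0" "v \<bullet> c > 0"
    and w: "refl_prod xs a = c" "refl_prod xs b = - (a + b + c)" "refl_prod xs c = a"
  shows "has_pattern P (refl_prod xs)"
proof (rule has_pattern_A3)
  show "{a, c} \<subseteq> P - inversions P (refl_prod xs)"
    using assms noninversionI [OF assms(1)] by (simp add: inner_add_right)
  show "{b, a + b, b + c, a + b + c} \<subseteq> inversions P (refl_prod xs)"
    using assms by (auto intro!: inversionI simp: inner_add_right inner_diff_right)
qed

lemma has_pattern_D4I:
  assumes "set xs \<subseteq> \<Delta>"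
    and "{a, b, c, d, a + b, b + c, b + d, a + b + c, a + b + d, b + c + d, a + b + c + d, a + b + b + c + d} \<subseteq> \<Phi>"
    and "v \<bullet> a > 0" "v \<bullet> b > 0" "v \<bullet> c > 0" "v \<bullet> d > 0"
    and w: "refl_prod xs a = b + c + d" "refl_prod xs b = - (a + b + b + c + d)"
      "refl_prod xs c = a + b + d" "refl_prod xs d = a + b + c"
  shows "has_pattern P (refl_prod xs)"
proof (rule has_pattern_D4)
  show "{a, c, d, a + b + c, a + b + d, b + c + d, a + b + c + d} \<subseteq> P - inversions P (refl_prod xs)"
    unfolding insert_subset
    by (intro conjI empty_subsetI noninversionI [OF assms(1)])
       (use assms in \<open>simp_all add: inner_add_right inner_diff_right\<close>)
  show "{b, a + b, b + c, b + d, a + b + b + c + d} \<subseteq> inversions P (refl_prod xs)"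
    unfolding insert_subset
    by (intro conjI empty_subsetI inversionI)
       (use assms in \<open>simp_all add: inner_add_right inner_diff_right\<close>)
qed

text \<open>The negative of the usual Cartan integer, hence nonnegative on distinct simple roots.\<close>

definition cartan :: "'a \<Rightarrow> 'a \<Rightarrow> real" where
  "cartan \<alpha> \<tau> = - (2 * (\<alpha> \<bullet> \<tau>) / (\<tau> \<bullet> \<tau>))"

lemma root_refl_cartan: "root_refl \<tau> \<alpha> = \<alpha> + cartan \<alpha> \<tau> *\<^sub>R \<tau>"
  by (simp add: root_refl_def cartan_def)

lemma cartan_nat:
  assumes "\<alpha> \<in> \<Delta>" "\<tau> \<in> \<Delta>" "\<alpha> \<noteq> \<tau>" "\<tau> \<bullet> \<alpha> \<noteq> 0"
  obtains n :: nat where "n \<ge> 1" "cartan \<alpha> \<tau> = real n"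
proof -
  have "\<alpha> \<bullet> \<tau> < 0" using simple_inner_nonpos [OF assms(1,2,3)] assms(4) by (simp add: inner_commute)
  moreover have "\<tau> \<bullet> \<tau> > 0" using root_inner_pos simple_root assms by auto
  ultimately have "cartan \<alpha> \<tau> > 0" by (simp add: cartan_def divide_neg_pos)
  moreover have "cartan \<alpha> \<tau> \<in> \<int>" unfolding cartan_def
    using cartan_integer [of \<tau> \<alpha>] simple_root assms by (intro Ints_minus) auto
  ultimately obtain k :: int where "cartan \<alpha> \<tau> = k" "k > 0" by (auto simp: Ints_def)
  then show ?thesis using that [of "nat k"] by simp
qed

text \<open>Rank two. For \<open>n = 1\<close> the roots \<open>\<alpha>\<close> and
  \<open>t + (m - 1) \<alpha>\<close> generate an A_2 pattern. Otherwise \<open>t\<close> is short: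
  \<open>n = 2\<close> is B_2, an A_3 with both ends folded onto \<open>t\<close>, and
  \<open>n = 3\<close> is G_2, a D_4 with three ends folded onto \<open>t\<close>.\<close>

lemma one_neighbour_pattern:
  assumes "\<alpha> \<in> \<Delta>" "t \<in> \<Delta>" and n: "n \<ge> 1" "m \<ge> 1" "n * m < (4::nat)"
    and c: "cartan \<alpha> t = real n" "cartan t \<alpha> = real m"
  shows "has_pattern P (refl_prod [\<alpha>, t, \<alpha>])"
proof -
  have sub: "set [\<alpha>, t, \<alpha>] \<subseteq> \<Delta>" and R: "\<alpha> \<in> \<Phi>" "t \<in> \<Phi>" using assms simple_root by auto
  have v: "v \<bullet> \<alpha> > 0" "v \<bullet> t > 0" using assms simple_pos pos_inner by auto
  have s: "root_refl \<alpha> t = t + real m *\<^sub>R \<alpha>" and t: "root_refl t \<alpha> = \<alpha> + real n *\<^sub>R t"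
    using root_refl_cartan c by metis+
  note st = root_refl_root [OF R(1) root_refl_root [OF R(2) R(1)]]
    and ts = root_refl_root [OF R(2) root_refl_root [OF R(1) R(2)]]
    and sts = root_refl_root [OF R(1) root_refl_root [OF R(2) root_refl_root [OF R(1) R(2)]]]
    and sr = root_refl_root [OF R(1) R(2)] and tr = root_refl_root [OF R(2) R(1)]
  have nm: "n = 1 \<or> (m = 1 \<and> n = 2) \<or> (m = 1 \<and> n = 3)"
  proof (cases "m = 1")
    case False
    then have "n * 2 \<le> n * m" using n by simp
    then show ?thesis using n by linarith
  qed (use n in auto)
  then consider "n = 1" | "m = 1" "n = 2" | "m = 1" "n = 3" by blast
  then show ?thesis
  proof cases
    case 1
    have st': "root_refl \<alpha> (root_refl t \<alpha>) = t + (real m - 1) *\<^sub>R \<alpha>"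
      by (simp add: s t 1 algebra_simps)
    have m: "(real m - 1) * (v \<bullet> \<alpha>) \<ge> 0" using n v by simp
    have w: "refl_prod [\<alpha>, t, \<alpha>] \<alpha> = - (t + (real m - 1) *\<^sub>R \<alpha>)" by (simp add: s t 1 algebra_simps)
    have "v \<bullet> refl_prod [\<alpha>, t, \<alpha>] \<alpha> < 0"
      using m v unfolding w inner_minus_right inner_add_right inner_scaleR_right by linarith
    then have "\<alpha> \<in> inversions P (refl_prod [\<alpha>, t, \<alpha>])" by (rule inversionI [OF R(1) v(1)])
    moreover have "t + (real m - 1) *\<^sub>R \<alpha> \<in> inversions P (refl_prod [\<alpha>, t, \<alpha>])"
    proof -
      have "v \<bullet> root_refl \<alpha> (root_refl t \<alpha>) > 0"
        using m v unfolding st' inner_add_right inner_scaleR_right by linarith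
      moreover have "refl_prod [\<alpha>, t, \<alpha>] (root_refl \<alpha> (root_refl t \<alpha>)) = - \<alpha>" by simp
      ultimately show ?thesis
        using inversionI [OF st, of "refl_prod [\<alpha>, t, \<alpha>]"] v(1) unfolding st' by simp
    qed
    moreover have "\<alpha> + (t + (real m - 1) *\<^sub>R \<alpha>) \<in> inversions P (refl_prod [\<alpha>, t, \<alpha>])"
    proof -
      have eq: "\<alpha> + (t + (real m - 1) *\<^sub>R \<alpha>) = root_refl \<alpha> t" by (simp add: s algebra_simps)
      have "v \<bullet> root_refl \<alpha> t > 0" using v by (simp add: s inner_add_right add_pos_nonneg)
      moreover have "refl_prod [\<alpha>, t, \<alpha>] (root_refl \<alpha> t) = - root_refl \<alpha> t" by simp
      ultimately show ?thesis unfolding eq using sr by (intro inversionI) simp_all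
    qed
    ultimately show ?thesis by (rule has_pattern_A2)
  next
    case 2
    show ?thesis
    proof (rule has_pattern_A3I [OF sub, of t \<alpha> t])
      show "{t, \<alpha>, t, t + \<alpha>, \<alpha> + t, t + \<alpha> + t} \<subseteq> \<Phi>"
        using R sr tr by (simp add: s t 2 algebra_simps scaleR_2)
    qed (use v in \<open>simp_all add: s t 2 algebra_simps scaleR_2\<close>)
  next
    case 3
    have three: "(3::real) *\<^sub>R x = x + x + x" for x :: 'a
      using scaleR_add_left [of 2 1 x] by (simp add: scaleR_2)
    show ?thesis
    proof (rule has_pattern_D4I [OF sub, of t \<alpha> t t])
      show "{t, \<alpha>, t, t, t + \<alpha>, \<alpha> + t, \<alpha> + t, t + \<alpha> + t, t + \<alpha> + t, \<alpha> + t + t, t + \<alpha> + t + t,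
          t + \<alpha> + \<alpha> + t + t} \<subseteq> \<Phi>"
        using R sr tr st ts by (simp add: s t 3 three algebra_simps)
    qed (use v in \<open>simp_all add: s t 3 three algebra_simps\<close>)
  qed
qed

text \<open>The ordering of the products forces a simple link between \<open>t\<close> and
  \<open>\<alpha>\<close>. Beside A_3 itself, B_3 is a D_4 with two ends folded onto
  \<open>u\<close>, and in C_3 the third simple root of A_3 is sent to
  \<open>u + \<alpha>\<close>.\<close>

lemma two_neighbours_pattern:
  assumes D: "\<alpha> \<in> \<Delta>" "t \<in> \<Delta>" "u \<in> \<Delta>" and tu: "t \<bullet> u = 0"
    and n: "n \<ge> 1" "m \<ge> 1" "n' \<ge> 1" "m' \<ge> 1" "n * m + n' * m' < (4::nat)" and nm: "n * m \<le> n' * m'"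
    and c: "cartan \<alpha> t = real n" "cartan t \<alpha> = real m" "cartan \<alpha> u = real n'" "cartan u \<alpha> = real m'"
  shows "has_pattern P (refl_prod [\<alpha>, t, u, \<alpha>])"
proof -
  have sub: "set [\<alpha>, t, u, \<alpha>] \<subseteq> \<Delta>" and R: "\<alpha> \<in> \<Phi>" "t \<in> \<Phi>" "u \<in> \<Phi>" using D simple_root by auto
  have v: "v \<bullet> \<alpha> > 0" "v \<bullet> t > 0" "v \<bullet> u > 0" using D simple_pos pos_inner by auto
  have "n * m = 1"
  proof (rule ccontr)
    assume "n * m \<noteq> 1"
    moreover have "n * m \<noteq> 0" using n by simp
    ultimately have "n * m \<ge> 2" by linarith
    then show False using n nm by linarith
  qed
  then have 1: "n = 1" "m = 1" by auto
  then have "n' * m' < 3" using n by simp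
  have "n' \<le> n' * m'" "m' \<le> n' * m'" using n by auto
  then have "n' \<le> 2" "m' \<le> 2" using \<open>n' * m' < 3\<close> by linarith+
  then have n': "n' = 1 \<or> n' = 2" "m' = 1 \<or> m' = 2" using n by linarith+
  have s: "root_refl \<alpha> t = t + \<alpha>" "root_refl \<alpha> u = u + real m' *\<^sub>R \<alpha>"
    and t: "root_refl t \<alpha> = \<alpha> + t" "root_refl u \<alpha> = \<alpha> + real n' *\<^sub>R u"
      "root_refl t u = u" "root_refl u t = t"
    using root_refl_cartan [of \<alpha> t] root_refl_cartan [of \<alpha> u] root_refl_cartan [of t \<alpha>] root_refl_cartan [of u \<alpha>]
      root_refl_orthogonal [of t u] root_refl_orthogonal [of u t] c 1 tu by (simp_all add: inner_commute)
  note r = root_refl_root [OF R(1)] root_refl_root [OF R(2)] root_refl_root [OF R(3)]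
  note roots = R r(1) [OF R(2)] r(1) [OF R(3)] r(2) [OF R(1)] r(3) [OF R(1)] r(2) [OF r(1) [OF R(3)]]
    r(2) [OF r(3) [OF R(1)]] r(1) [OF r(2) [OF r(3) [OF R(1)]]]
  show ?thesis
    using n' \<open>n' * m' < 3\<close>
  proof (elim disjE)
    assume [simp]: "n' = 1" "m' = 1"
    show ?thesis
    proof (rule has_pattern_A3I [OF sub, of t \<alpha> u])
      show "{t, \<alpha>, u, t + \<alpha>, \<alpha> + u, t + \<alpha> + u} \<subseteq> \<Phi>" using roots by (simp add: s t algebra_simps)
    qed (use v in \<open>simp_all add: s t algebra_simps\<close>)
  next
    assume [simp]: "n' = 2" "m' = 1"
    show ?thesis
    proof (rule has_pattern_D4I [OF sub, of t \<alpha> u u])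
      show "{t, \<alpha>, u, u, t + \<alpha>, \<alpha> + u, \<alpha> + u, t + \<alpha> + u, t + \<alpha> + u, \<alpha> + u + u, t + \<alpha> + u + u,
          t + \<alpha> + \<alpha> + u + u} \<subseteq> \<Phi>" using roots by (simp add: s t algebra_simps scaleR_2)
    qed (use v in \<open>simp_all add: s t algebra_simps scaleR_2\<close>)
  next
    assume [simp]: "n' = 1" "m' = 2"
    show ?thesis
    proof (rule has_pattern_A3I [OF sub, of t \<alpha> "u + \<alpha>"])
      show "{t, \<alpha>, u + \<alpha>, t + \<alpha>, \<alpha> + (u + \<alpha>), t + \<alpha> + (u + \<alpha>)} \<subseteq> \<Phi>"
        using roots by (simp add: s t algebra_simps scaleR_2)
    qed (use v in \<open>simp_all add: s t algebra_simps scaleR_2\<close>)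
  qed simp
qed

text \<open>Three neighbours leave room for simple links only, and the word is the D_4 pattern
  itself.\<close>

lemma three_neighbours_pattern:
  assumes D: "\<alpha> \<in> \<Delta>" "t \<in> \<Delta>" "u \<in> \<Delta>" "x \<in> \<Delta>" and orth: "t \<bullet> u = 0" "t \<bullet> x = 0" "u \<bullet> x = 0"
    and c: "cartan \<alpha> t = 1" "cartan t \<alpha> = 1" "cartan \<alpha> u = 1" "cartan u \<alpha> = 1" "cartan \<alpha> x = 1" "cartan x \<alpha> = 1"
  shows "has_pattern P (refl_prod [\<alpha>, t, u, x, \<alpha>])"
proof -
  have sub: "set [\<alpha>, t, u, x, \<alpha>] \<subseteq> \<Delta>" and R: "\<alpha> \<in> \<Phi>" "t \<in> \<Phi>" "u \<in> \<Phi>" "x \<in> \<Phi>" using D simple_root by auto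
  have v: "v \<bullet> \<alpha> > 0" "v \<bullet> t > 0" "v \<bullet> u > 0" "v \<bullet> x > 0" using D simple_pos pos_inner by auto
  have s: "root_refl \<alpha> t = t + \<alpha>" "root_refl \<alpha> u = u + \<alpha>" "root_refl \<alpha> x = x + \<alpha>"
    and t: "root_refl t \<alpha> = \<alpha> + t" "root_refl u \<alpha> = \<alpha> + u" "root_refl x \<alpha> = \<alpha> + x"
    using root_refl_cartan [of \<alpha>] root_refl_cartan [of _ \<alpha>] c by simp_all
  have o: "root_refl t u = u" "root_refl u t = t" "root_refl t x = x" "root_refl x t = t" "root_refl u x = x" "root_refl x u = u"
    by (rule root_refl_orthogonal, use orth in \<open>simp add: inner_commute\<close>)+
  note r = root_refl_root [OF R(1)] root_refl_root [OF R(2)] root_refl_root [OF R(3)] root_refl_root [OF R(4)]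
  note roots = R r(1) [OF R(2)] r(1) [OF R(3)] r(1) [OF R(4)] r(2) [OF r(1) [OF R(3)]]
    r(2) [OF r(1) [OF R(4)]] r(3) [OF r(1) [OF R(4)]] r(2) [OF r(3) [OF r(1) [OF R(4)]]]
    r(1) [OF r(2) [OF r(3) [OF r(1) [OF R(4)]]]]
  show ?thesis
  proof (rule has_pattern_D4I [OF sub, of t \<alpha> u x])
    show "{t, \<alpha>, u, x, t + \<alpha>, \<alpha> + u, \<alpha> + x, t + \<alpha> + u, t + \<alpha> + x, \<alpha> + u + x, t + \<alpha> + u + x,
      t + \<alpha> + \<alpha> + u + x} \<subseteq> \<Phi>" using roots by (simp add: s t o algebra_simps)
  qed (use v in \<open>simp_all add: s t o algebra_simps\<close>)
qed

end

section \<open>Words with a repeated letter\<close>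

lemma subseq_distinct: "subseq xs ys \<Longrightarrow> distinct ys \<Longrightarrow> distinct xs"
proof (induction rule: list_emb.induct)
  case (list_emb_Cons2 x y xs ys)
  then show ?case using subseq_subset [of xs ys] by auto
qed auto

context positive_roots
begin

text \<open>The product of the two Cartan integers is four times the squared cosine, and for linked
  roots it is at least 1.\<close>

lemma inner_sgn_simple:
  assumes "\<alpha> \<in> \<Delta>" "\<tau> \<in> \<Delta>" "\<alpha> \<noteq> \<tau>"
  shows "sgn \<alpha> \<bullet> sgn \<tau> \<le> 0" and "\<alpha> \<bullet> \<tau> \<noteq> 0 \<Longrightarrow> sgn \<alpha> \<bullet> sgn \<tau> \<le> - (1/2)"
proof -
  have eq: "sgn \<alpha> \<bullet> sgn \<tau> = (\<alpha> \<bullet> \<tau>) / (norm \<alpha> * norm \<tau>)"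
    by (simp add: sgn_div_norm divide_inverse)
  show le: "sgn \<alpha> \<bullet> sgn \<tau> \<le> 0"
    unfolding eq using simple_inner_nonpos [OF assms] by (simp add: divide_nonpos_nonneg)
  assume ne: "\<alpha> \<bullet> \<tau> \<noteq> 0"
  obtain n where n: "n \<ge> 1" "cartan \<alpha> \<tau> = real n" using cartan_nat [of \<alpha> \<tau>] assms ne by (auto simp: inner_commute)
  obtain m where m: "m \<ge> 1" "cartan \<tau> \<alpha> = real m" using cartan_nat [of \<tau> \<alpha>] assms ne by auto
  have "1 \<le> real n * real m" using n m by (simp add: mult_ge1_I)
  also have "\<dots> = 4 * (sgn \<alpha> \<bullet> sgn \<tau>)\<^sup>2"
    unfolding n(2) [symmetric] m(2) [symmetric] eq cartan_def
    by (simp add: power2_eq_square inner_commute dot_square_norm)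
  finally have "(1/2)\<^sup>2 \<le> (- (sgn \<alpha> \<bullet> sgn \<tau>))\<^sup>2" by (simp add: power2_eq_square)
  then have "1/2 \<le> - (sgn \<alpha> \<bullet> sgn \<tau>)" by (rule power2_le_imp_le) (use le in simp)
  then show "sgn \<alpha> \<bullet> sgn \<tau> \<le> - (1/2)" by simp
qed

lemma inner_sgn_self: "\<alpha> \<in> \<Delta> \<Longrightarrow> sgn \<alpha> \<bullet> sgn \<alpha> = 1"
  using zero_notin_roots simple_root by (auto simp: dot_square_norm norm_sgn)

abbreviation linked :: "'a \<Rightarrow> 'a \<Rightarrow> bool" where "linked x y \<equiv> x \<bullet> y \<noteq> 0"

text \<open>A vertex put in front adds its squared norm 1, but twice its product with the rest of
  the path is at most -1.\<close>

lemma path_norm_le: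
  assumes "distinct xs" "set xs \<subseteq> \<Delta>" "successively linked xs" "xs \<noteq> []"
  shows "(\<Sum>x\<in>set xs. sgn x) \<bullet> (\<Sum>x\<in>set xs. sgn x) \<le> 1"
  using assms
proof (induction xs rule: induct_list012)
  case (2 x)
  then show ?case using inner_sgn_self by simp
next
  case (3 x y zs)
  let ?S = "\<Sum>x\<in>set (y # zs). sgn x"
  have IH: "?S \<bullet> ?S \<le> 1" using 3 by simp
  have sum: "(\<Sum>x\<in>set (x # y # zs). sgn x) = sgn x + ?S" using 3 by simp
  have S: "?S = sgn y + (\<Sum>x\<in>set zs. sgn x)" using 3 by simp
  have "sgn x \<bullet> (\<Sum>x\<in>set zs. sgn x) \<le> 0"
    unfolding inner_sum_right by (rule sum_nonpos) (use inner_sgn_simple(1) [of x] 3 in auto)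
  moreover have "sgn x \<bullet> sgn y \<le> - (1/2)" using inner_sgn_simple(2) [of x y] 3 by auto
  ultimately have "sgn x \<bullet> ?S \<le> - (1/2)" unfolding S inner_add_right by linarith
  moreover have "(sgn x + ?S) \<bullet> (sgn x + ?S) = sgn x \<bullet> sgn x + ?S \<bullet> ?S + 2 * (sgn x \<bullet> ?S)"
    by (simp only: inner_add_left inner_add_right inner_commute [of ?S "sgn x"])
  moreover have "sgn x \<bullet> sgn x = 1" using inner_sgn_self 3 by simp
  ultimately show ?case unfolding sum using IH by linarith
qed simp

text \<open>The unit vectors along a cycle in the Dynkin diagram would add up to zero.\<close>

lemma no_cycle:
  assumes xs: "distinct xs" "set xs \<subseteq> \<Delta>" "successively linked xs" "length xs \<ge> 2"
    and a: "\<alpha> \<in> \<Delta>" "\<alpha> \<notin> set xs" "linked \<alpha> (hd xs)" "linked \<alpha> (last xs)"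
  shows False
proof -
  let ?S = "\<Sum>x\<in>set xs. sgn x" and ?x = "hd xs" and ?y = "last xs"
  \<comment> \<open>With at least two vertices, \<open>?x\<close> and \<open>?y\<close> differ, and
    each contributes at most -1/2 to the product with \<open>sgn \<alpha>\<close>.\<close>
  obtain x ys where x: "xs = x # ys" "ys \<noteq> []" using xs(4) by (cases xs) (auto simp: Suc_le_eq)
  have mem: "?x \<in> set xs" "?y \<in> set xs - {?x}" using x xs(1) by auto
  have "?S = sgn ?x + (sgn ?y + (\<Sum>x\<in>set xs - {?x} - {?y}. sgn x))"
    using mem by (simp add: sum.remove)
  moreover have "sgn \<alpha> \<bullet> (\<Sum>x\<in>set xs - {?x} - {?y}. sgn x) \<le> 0"
    unfolding inner_sum_right by (rule sum_nonpos) (use inner_sgn_simple(1) [of \<alpha>] xs a in auto)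
  moreover have "sgn \<alpha> \<bullet> sgn ?x \<le> - (1/2)" "sgn \<alpha> \<bullet> sgn ?y \<le> - (1/2)"
    by (rule inner_sgn_simple(2); use mem xs(2) a in auto)+
  ultimately have "sgn \<alpha> \<bullet> ?S \<le> -1" by (simp only: inner_add_right)
  moreover have "?S \<bullet> ?S \<le> 1" using path_norm_le [OF xs(1,2,3)] x by blast
  moreover have "(sgn \<alpha> + ?S) \<bullet> (sgn \<alpha> + ?S) = sgn \<alpha> \<bullet> sgn \<alpha> + ?S \<bullet> ?S + 2 * (sgn \<alpha> \<bullet> ?S)"
    by (simp only: inner_add_left inner_add_right inner_commute [of ?S "sgn \<alpha>"])
  ultimately have "(sgn \<alpha> + ?S) \<bullet> (sgn \<alpha> + ?S) \<le> 0" using inner_sgn_self [OF a(1)] by linarith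
  then have "sgn \<alpha> + ?S = 0" using inner_ge_zero [of "sgn \<alpha> + ?S"] inner_eq_zero_iff [of "sgn \<alpha> + ?S"] by linarith
  moreover have "v \<bullet> sgn x > 0" if "x \<in> \<Delta>" for x
    using pos_inner [OF simple_pos [OF that]] by (auto simp: sgn_div_norm zero_less_mult_iff)
  then have "v \<bullet> sgn \<alpha> > 0" "v \<bullet> ?S \<ge> 0"
    unfolding inner_sum_right using a(1) xs(2) by (auto intro!: sum_nonneg intro: less_imp_le)
  ultimately show False by (metis add_pos_nonneg inner_add_right inner_zero_right less_irrefl)
qed

text \<open>A letter orthogonal to all later ones can be moved to the right end. The left end is
  covered by \<open>ends_linked \<alpha> (rev u)\<close>.\<close>

definition ends_linked :: "'a \<Rightarrow> 'a list \<Rightarrow> bool" where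
  "ends_linked \<alpha> u \<longleftrightarrow> (\<forall>u1 t u2. u = u1 @ t # u2 \<longrightarrow> (\<forall>y\<in>set u2. t \<bullet> y = 0) \<longrightarrow> linked \<alpha> t)"

text \<open>From \<open>t\<close>, jump to a later linked letter as long as there is one; the last
  letter reached can be moved to the right end.\<close>

lemma ends_linked_path:
  assumes "ends_linked \<alpha> u" "u = u1 @ t # u2"
  shows "\<exists>ys. subseq ys u2 \<and> successively linked (t # ys) \<and> linked \<alpha> (last (t # ys))"
  using assms(2)
proof (induction "length u2" arbitrary: u1 t u2 rule: less_induct)
  case less
  show ?case
  proof (cases "\<forall>y\<in>set u2. t \<bullet> y = 0")
    case True
    then have "linked \<alpha> t" using assms(1) less.prems unfolding ends_linked_def by blast
    then show ?thesis by (intro exI [of _ "[]"]) simp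
  next
    case False
    then obtain y v1 v2 where y: "u2 = v1 @ y # v2" "linked t y" using split_list by metis
    have "length v2 < length u2" "u = (u1 @ t # v1) @ y # v2" using y less.prems by auto
    from less.hyps [OF this] obtain ys where
      ys: "subseq ys v2" "successively linked (y # ys)" "linked \<alpha> (last (y # ys))" by blast
    have "subseq (y # ys) u2" unfolding y(1) using ys(1) by (intro list_emb_append2) simp
    then show ?thesis using y(2) ys(2,3) by (intro exI [of _ "y # ys"]) simp
  qed
qed

text \<open>If \<open>p\<close> and \<open>q\<close> were linked, a path from \<open>p\<close> to
  the left and one from \<open>q\<close> to the right, both ending at neighbours of
  \<open>\<alpha>\<close>, would close up to a cycle through \<open>\<alpha>\<close>; they use
  disjoint parts of \<open>u\<close>, so no vertex repeats.\<close>

lemma ends_linked_orthogonal: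
  assumes u: "ends_linked \<alpha> u" "ends_linked \<alpha> (rev u)" "distinct u" "set u \<subseteq> \<Delta>"
    and a: "\<alpha> \<in> \<Delta>" "\<alpha> \<notin> set u" and eq: "u = u1 @ p # u2 @ q # u3"
  shows "p \<bullet> q = 0"
proof (rule ccontr)
  assume pq: "p \<bullet> q \<noteq> 0"
  obtain ys where ys: "subseq ys u3" "successively linked (q # ys)" "linked \<alpha> (last (q # ys))"
    using ends_linked_path [OF u(1), of "u1 @ p # u2" q u3] eq by auto
  obtain zs where zs: "subseq zs (rev u1)" "successively linked (p # zs)" "linked \<alpha> (last (p # zs))"
    using ends_linked_path [OF u(2), of "rev u3 @ q # rev u2" p "rev u1"] eq by auto
  let ?L = "rev (p # zs) @ (q # ys)"
  have sets: "set ys \<subseteq> set u3" "set zs \<subseteq> set u1" using subseq_subset ys zs by fastforce+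
  have "distinct ys" "distinct zs" using subseq_distinct [OF ys(1)] subseq_distinct [OF zs(1)] u(3) eq by auto
  then have "distinct ?L" using sets u(3) eq by auto
  moreover have "set ?L \<subseteq> set u" using sets eq by auto
  moreover have "successively linked (rev (p # zs))"
    unfolding successively_rev using zs(2) by (simp only: inner_commute)
  then have "successively linked ?L"
    using ys(2) pq unfolding successively_append_iff by simp
  moreover have "hd ?L = last (p # zs)" by (simp add: hd_append hd_rev)
  moreover have "last ?L = last (q # ys)" by simp
  moreover have "length ?L \<ge> 2" by simp
  ultimately show False using no_cycle [of ?L \<alpha>] u(4) a ys(3) zs(3) by (metis subset_iff)
qed

text \<open>Up to the factor \<open>4 / (\<alpha> \<bullet> \<alpha>)\<close>, the sum is the
  squared norm of the projection \<open>y\<close> of \<open>\<alpha>\<close> to the span of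
  \<open>T\<close>. Bessel's inequality is strict because \<open>\<alpha>\<close> is independent of
  \<open>T\<close>.\<close>

lemma sum_cartan_less:
  assumes "finite T" "T \<subseteq> \<Delta>" "\<alpha> \<in> \<Delta>" "\<alpha> \<notin> T"
    and orth: "\<And>x y. x \<in> T \<Longrightarrow> y \<in> T \<Longrightarrow> x \<noteq> y \<Longrightarrow> x \<bullet> y = 0"
  shows "(\<Sum>\<tau>\<in>T. cartan \<alpha> \<tau> * cartan \<tau> \<alpha>) < 4"
proof -
  define c where "c \<tau> = (\<alpha> \<bullet> \<tau>) / (\<tau> \<bullet> \<tau>)" for \<tau>
  define y where "y = (\<Sum>\<tau>\<in>T. c \<tau> *\<^sub>R \<tau>)"
  define Q where "Q = (\<Sum>\<tau>\<in>T. c \<tau> * (\<alpha> \<bullet> \<tau>))"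
  have T: "\<tau> \<bullet> \<tau> > 0" "coef \<alpha> \<tau> = 0" if "\<tau> \<in> T" for \<tau>
  proof -
    have "\<tau> \<in> \<Delta>" "\<tau> \<noteq> \<alpha>" using that assms by auto
    then show "\<tau> \<bullet> \<tau> > 0" "coef \<alpha> \<tau> = 0" using root_inner_pos [OF simple_root] coef_simple by auto
  qed
  have "\<tau> \<bullet> y = \<alpha> \<bullet> \<tau>" if "\<tau> \<in> T" for \<tau>
  proof -
    have "\<tau> \<bullet> y = (\<Sum>\<sigma>\<in>T. if \<sigma> = \<tau> then c \<tau> * (\<tau> \<bullet> \<tau>) else 0)"
      unfolding y_def inner_sum_right by (intro sum.cong) (use that orth in auto)
    then show ?thesis using assms(1) that T(1) [OF that] by (simp add: c_def)
  qed
  then have yy: "y \<bullet> y = Q"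
    by (subst (1) y_def) (simp add: inner_sum_left Q_def)
  have ay: "\<alpha> \<bullet> y = Q" by (simp add: y_def Q_def inner_sum_right)
  have "coef \<alpha> y = 0" using T(2) by (simp add: y_def linear_sum [OF linear_coef])
  then have "coef \<alpha> (\<alpha> - y) = 1" using coef_simple [OF assms(3)] by simp
  then have "\<alpha> - y \<noteq> 0" using linear_0 [OF linear_coef, of \<alpha>] by auto
  then have "(\<alpha> - y) \<bullet> (\<alpha> - y) > 0" by simp
  then have "Q < \<alpha> \<bullet> \<alpha>" using ay yy by (simp add: inner_diff_left inner_diff_right inner_commute)
  moreover have "\<alpha> \<bullet> \<alpha> > 0" using assms root_inner_pos simple_root by auto
  moreover have "(\<Sum>\<tau>\<in>T. cartan \<alpha> \<tau> * cartan \<tau> \<alpha>) = 4 / (\<alpha> \<bullet> \<alpha>) * Q"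
    unfolding Q_def sum_distrib_left
    by (intro sum.cong) (simp_all add: cartan_def c_def inner_commute)
  moreover have "4 / A * Q < 4" if "Q < A" "A > 0" for A using that by (simp add: field_simps)
  ultimately show ?thesis by simp
qed

lemma neighbours_pattern:
  assumes u: "distinct u" "set u \<subseteq> \<Delta>" "u \<noteq> []" and a: "\<alpha> \<in> \<Delta>" "\<alpha> \<notin> set u"
    and orth: "\<And>x y. x \<in> set u \<Longrightarrow> y \<in> set u \<Longrightarrow> x \<noteq> y \<Longrightarrow> x \<bullet> y = 0"
    and link: "\<And>x. x \<in> set u \<Longrightarrow> linked \<alpha> x"
  shows "has_pattern P (refl_prod (\<alpha> # u @ [\<alpha>]))"
proof -
  have "\<exists>n\<ge>1. cartan \<alpha> x = real n" "\<exists>m\<ge>1. cartan x \<alpha> = real m" if "x \<in> set u" for x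
  proof -
    have "x \<in> \<Delta>" "\<alpha> \<noteq> x" "x \<noteq> \<alpha>" "\<alpha> \<bullet> x \<noteq> 0" "x \<bullet> \<alpha> \<noteq> 0"
      using that u(2) a link [OF that] by (auto simp: inner_commute)
    then show "\<exists>n\<ge>1. cartan \<alpha> x = real n" "\<exists>m\<ge>1. cartan x \<alpha> = real m"
      using cartan_nat [of \<alpha> x] cartan_nat [of x \<alpha>] a(1) by metis+
  qed
  then obtain n m :: "'a \<Rightarrow> nat" where nm: "\<And>x. x \<in> set u \<Longrightarrow> n x \<ge> 1 \<and> cartan \<alpha> x = real (n x)"
    "\<And>x. x \<in> set u \<Longrightarrow> m x \<ge> 1 \<and> cartan x \<alpha> = real (m x)" by metis
  have "real (\<Sum>x\<in>set u. n x * m x) = (\<Sum>x\<in>set u. cartan \<alpha> x * cartan x \<alpha>)"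
    using nm by simp
  also have "\<dots> < 4" by (rule sum_cartan_less) (use u a orth in auto)
  finally have less: "(\<Sum>x\<in>set u. n x * m x) < 4" by linarith
  have ge: "n x * m x \<ge> 1" if "x \<in> set u" for x using nm [OF that] by (simp add: mult_ge1_I)
  have "(\<Sum>x\<in>set u. 1) \<le> (\<Sum>x\<in>set u. n x * m x)" using ge by (intro sum_mono) auto
  then have "length u < 4" using less distinct_card [OF u(1)] by simp
  moreover have "length u \<noteq> 0" using u(3) by simp
  ultimately have "length u = 1 \<or> length u = 2 \<or> length u = 3" by linarith
  then have "(\<exists>t. u = [t]) \<or> (\<exists>t s. u = [t, s]) \<or> (\<exists>t s r. u = [t, s, r])"
    by (auto simp: numeral_eq_Suc length_Suc_conv)
  then consider t where "u = [t]" | t s where "u = [t, s]" | t s r where "u = [t, s, r]" by blast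
  then show ?thesis
  proof cases
    case 1
    then show ?thesis using one_neighbour_pattern [of \<alpha> t "n t" "m t"] nm [of t] less u(2) a by simp
  next
    case 2
    have ts: "t \<bullet> s = 0" "s \<bullet> t = 0" using orth u(1) 2 by auto
    have D: "t \<in> \<Delta>" "s \<in> \<Delta>" and sum: "n t * m t + n s * m s < 4" using u 2 less by auto
    show ?thesis
    proof (cases "n t * m t \<le> n s * m s")
      case True
      then show ?thesis
        using two_neighbours_pattern [OF a(1) D ts(1), of "n t" "m t" "n s" "m s"] nm [of t] nm [of s] sum 2 by simp
    next
      case False
      \<comment> \<open>The letters commute, so the one with the smaller product may come first, as
        \<open>two_neighbours_pattern\<close> demands.\<close>
      have "refl_prod [\<alpha>, t, s, \<alpha>] = refl_prod [\<alpha>, s, t, \<alpha>]"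
        using root_refl_comm [OF ts(1)] by (simp add: fun_eq_iff)
      then show ?thesis
        using two_neighbours_pattern [OF a(1) D(2,1) ts(2), of "n s" "m s" "n t" "m t"] nm [of t] nm [of s] sum 2 False by simp
    qed
  next
    case 3
    have "n t * m t + (n s * m s + n r * m r) < 4" using less u(1) 3 by simp
    moreover have "n t * m t \<ge> 1" "n s * m s \<ge> 1" "n r * m r \<ge> 1" by (rule ge; simp add: 3)+
    ultimately have "n t * m t = 1" "n s * m s = 1" "n r * m r = 1" by linarith+
    then have "n t = 1" "m t = 1" "n s = 1" "m s = 1" "n r = 1" "m r = 1" by auto
    then show ?thesis
      using three_neighbours_pattern [of \<alpha> t s r] nm [of t] nm [of s] nm [of r] u a orth 3 by simp
  qed
qed

lemma ends_linked_or_pattern: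
  assumes red: "reduced (\<alpha> # u @ [\<alpha>])"
    and IH: "\<And>ys. length ys < length u + 2 \<Longrightarrow> reduced ys \<Longrightarrow> \<not> distinct ys \<Longrightarrow> has_pattern P (refl_prod ys)"
  shows "ends_linked \<alpha> u \<or> has_pattern P (refl_prod (\<alpha> # u @ [\<alpha>]))"
proof (rule disjCI)
  assume no: "\<not> has_pattern P (refl_prod (\<alpha> # u @ [\<alpha>]))"
  show "ends_linked \<alpha> u" unfolding ends_linked_def
  proof (intro allI impI, rule ccontr)
    fix u1 t u2
    assume u: "u = u1 @ t # u2" and orth: "\<forall>y\<in>set u2. t \<bullet> y = 0" and "\<not> linked \<alpha> t"
    let ?ys = "\<alpha> # u1 @ u2 @ [\<alpha>]"
    \<comment> \<open>The letter \<open>t\<close> also commutes with the final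
      \<open>\<alpha>\<close>, so it moves behind it; a shorter word containing
      \<open>\<alpha>\<close> twice remains.\<close>
    have "refl_prod (t # u2 @ [\<alpha>]) = refl_prod ((u2 @ [\<alpha>]) @ [t])"
      by (rule refl_prod_move) (use orth \<open>\<not> linked \<alpha> t\<close> in \<open>auto simp: inner_commute\<close>)
    then have eq: "refl_prod (\<alpha> # u @ [\<alpha>]) = refl_prod (?ys @ [t])"
      using refl_prod_append [of "\<alpha> # u1" "t # u2 @ [\<alpha>]"] refl_prod_append [of "\<alpha> # u1" "(u2 @ [\<alpha>]) @ [t]"]
      unfolding u append_Cons append_assoc by argo
    have set: "set (?ys @ [t]) = set (\<alpha> # u @ [\<alpha>])" and len: "length (?ys @ [t]) = length (\<alpha> # u @ [\<alpha>])"
      by (auto simp: u)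
    then have "reduced (?ys @ [t])" using red unfolding reduced_def eq set len by blast
    moreover from this have "reduced ?ys" by (rule reduced_appendD1)
    then have "has_pattern P (refl_prod ?ys)" by (intro IH) (simp_all add: u)
    ultimately have "has_pattern P (refl_prod (?ys @ [t]))" by (rule has_pattern_snoc)
    then show False using no eq by simp
  qed
qed

text \<open>Unless the first and last letters form the only repetition, dropping one of them leaves
  a shorter word with a repetition.\<close>

lemma reduced_not_distinct_pattern:
  "reduced xs \<Longrightarrow> \<not> distinct xs \<Longrightarrow> has_pattern P (refl_prod xs)"
proof (induction "length xs" arbitrary: xs rule: less_induct)
  case less
  then obtain \<alpha> ys where xs: "xs = \<alpha> # ys" by (cases xs) auto
  show ?case
  proof (cases "distinct ys")
    case False
    then have "has_pattern P (refl_prod ys)" using less.hyps [of ys] less.prems by (simp add: xs reduced_Cons)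
    then show ?thesis using has_pattern_Cons less.prems unfolding xs by blast
  next
    case True
    then have "\<alpha> \<in> set ys" using less.prems by (simp add: xs)
    then obtain u z where ys: "ys = u @ [z]" by (cases ys rule: rev_cases) auto
    have xs': "xs = (\<alpha> # u) @ [z]" by (simp add: xs ys)
    show ?thesis
    proof (cases "distinct (\<alpha> # u)")
      case False
      have "reduced (\<alpha> # u)" using less.prems(1) reduced_appendD1 unfolding xs' by blast
      then have "has_pattern P (refl_prod (\<alpha> # u))" using less.hyps [of "\<alpha> # u"] False by (simp add: xs')
      then show ?thesis using has_pattern_snoc less.prems unfolding xs' by blast
    next
      case dist: True
      then have "z = \<alpha>" using \<open>\<alpha> \<in> set ys\<close> ys by simp
      then have xs: "xs = \<alpha> # u @ [\<alpha>]" by (simp add: xs')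
      have D: "set u \<subseteq> \<Delta>" "\<alpha> \<in> \<Delta>" and red: "reduced (\<alpha> # u @ [\<alpha>])" "reduced (\<alpha> # rev u @ [\<alpha>])"
        using reduced_subset [OF less.prems(1)] less.prems(1) reduced_rev [of xs] xs by auto
      have IH: "has_pattern P (refl_prod ys)" if "length ys < length u + 2" "reduced ys" "\<not> distinct ys" for ys
        using less.hyps [of ys] that by (simp add: xs)
      show ?thesis
      proof (rule ccontr)
        assume no: "\<not> has_pattern P (refl_prod xs)"
        \<comment> \<open>The reversed word controls the letters that can be moved to the left end
          of \<open>u\<close>.\<close>
        have "\<not> has_pattern P (refl_prod (\<alpha> # rev u @ [\<alpha>]))"
          using has_pattern_rev [of "\<alpha> # rev u @ [\<alpha>]"] no D xs by auto
        then have ends: "ends_linked \<alpha> u" "ends_linked \<alpha> (rev u)"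
          using no ends_linked_or_pattern [OF red(1) IH] ends_linked_or_pattern [OF red(2)] IH xs by auto
        note orth' = ends_linked_orthogonal [OF ends _ D(1) D(2)]
        have orth: "x \<bullet> y = 0" if xy: "x \<in> set u" "y \<in> set u" "x \<noteq> y" for x y
        proof -
          obtain u1 u2 where u: "u = u1 @ x # u2" using xy(1) split_list by metis
          show ?thesis
          proof (cases "y \<in> set u2")
            case True
            then obtain u3 u4 where "u2 = u3 @ y # u4" using split_list by metis
            then show ?thesis using orth' [of u1 x u3 y u4] dist u by simp
          next
            case False
            then have "y \<in> set u1" using xy u by auto
            then obtain u3 u4 where "u1 = u3 @ y # u4" using split_list by metis
            then have "y \<bullet> x = 0" using orth' [of u3 y u4 x u2] dist u by simp
            then show ?thesis by (simp add: inner_commute)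
          qed
        qed
        \<comment> \<open>All letters of \<open>u\<close> commute by now, so each of them can be
          moved to the right end.\<close>
        have link: "linked \<alpha> x" if x: "x \<in> set u" for x
        proof -
          obtain u1 u2 where u: "u = u1 @ x # u2" using x split_list by metis
          moreover have "\<forall>y\<in>set u2. x \<bullet> y = 0" using orth u dist by auto
          ultimately show ?thesis using ends(1) unfolding ends_linked_def by blast
        qed
        have "u \<noteq> []"
        proof
          assume "u = []"
          then have "- \<alpha> \<in> P" using red(1) by (simp add: reduced_Cons)
          then show False using uminus_notin_pos simple_pos D(2) by blast
        qed
        then have "has_pattern P (refl_prod (\<alpha> # u @ [\<alpha>]))"
          using neighbours_pattern [OF _ D(1) _ D(2) _ orth link] dist by simp
        then show False using no xs by simp
      qed
    qed
  qed
qed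

end

section \<open>Linear maps from the pattern root systems\<close>

lemma evec_nth: "evec i $ j = (if j = i then 1 else 0)"
  by (simp add: axis_def)

lemma root_refl_evec_diff:
  fixes i j k :: "'n::finite"
  assumes "i \<noteq> j"
  shows "root_refl (evec i - evec j) (evec k) = evec (if k = i then j else if k = j then i else k)"
  using assms by (auto simp: root_refl_def inner_axis_axis inner_diff_left inner_diff_right)

lemma root_refl_evec_sum:
  fixes i j k :: "'n::finite"
  assumes "i \<noteq> j"
  shows "root_refl (evec i + evec j) (evec k) = (if k = i then - evec j else if k = j then - evec i else evec k)"
  using assms by (auto simp: root_refl_def inner_axis_axis inner_add_left inner_add_right)

text \<open>In coordinates the patterns are the permutations 321 and 3412, and for D_4 the signed
  permutation that swaps the first and third axes and negates the other two.\<close>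

lemma A2_pattern_evec: "A2_pattern (evec 0) = evec 2" "A2_pattern (evec 1) = evec 1" "A2_pattern (evec 2) = evec 0"
  by (simp_all add: A2_pattern_def A2_simple_def root_refl_evec_diff)

lemma A3_pattern_evec: "A3_pattern (evec 0) = evec 2" "A3_pattern (evec 1) = evec 3"
  "A3_pattern (evec 2) = evec 0" "A3_pattern (evec 3) = evec 1"
  by (simp_all add: A3_pattern_def A3_simple_def root_refl_evec_diff)

lemma D4_pattern_evec: "D4_pattern (evec 0) = evec 2" "D4_pattern (evec 1) = - evec 1"
  "D4_pattern (evec 2) = evec 0" "D4_pattern (evec 3) = - evec 3"
  by (simp_all add: D4_pattern_def D4_simple_def root_refl_evec_diff root_refl_evec_sum)

text \<open>In the type \<open>3\<close>, the element 3 listed by \<open>exhaust_3\<close> is 0, the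
  least one.\<close>

lemma less_3_iff: "(i::3) < j \<longleftrightarrow> (i, j) \<in> {(0, 1), (0, 2), (1, 2)}"
  using exhaust_3 [of i] exhaust_3 [of j]
  by (elim disjE; simp add: less_bit1_def bit1.Rep_numeral bit1.Rep_1 bit1.Rep_0)

lemma less_4_iff: "(i::4) < j \<longleftrightarrow> (i, j) \<in> {(0, 1), (0, 2), (0, 3), (1, 2), (1, 3), (2, 3)}"
  using exhaust_4 [of i] exhaust_4 [of j]
  by (elim disjE; simp add: less_bit0_def bit0.Rep_numeral bit0.Rep_1 bit0.Rep_0)

text \<open>Listed as inversions of the pattern united with its non-inversions, the form expected by
  \<open>contains_pattern_iff\<close>; here all positive roots are inversions.\<close>

lemma A2_pos_eq: "A2_pos = {evec 0 - evec 1, evec 1 - evec 2, evec 0 - evec 2} \<union> {}"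
  unfolding pos_roots_A_def less_3_iff by auto

lemma A3_pos_eq: "A3_pos = {evec 1 - evec 2, evec 0 - evec 2, evec 1 - evec 3, evec 0 - evec 3} \<union>
    {evec 0 - evec 1, evec 2 - evec 3}"
  unfolding pos_roots_A_def less_4_iff by auto

lemma D4_pos_eq: "D4_pos =
    {evec 1 - evec 2, evec 0 - evec 2, evec 1 - evec 3, evec 1 + evec 3, evec 0 + evec 1} \<union>
    {evec 0 - evec 1, evec 2 - evec 3, evec 2 + evec 3, evec 0 - evec 3, evec 0 + evec 3,
     evec 1 + evec 2, evec 0 + evec 2}"
  unfolding pos_roots_D_def less_4_iff by auto

text \<open>The sign of \<open>h\<close> certifies that \<open>p\<close> moves the roots of
  \<open>A\<close> out of \<open>Rp\<close>, so \<open>A\<close> is the inversion set without any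
  comparison of vectors.\<close>

lemma contains_pattern_iff:
  assumes Rp: "Rp = A \<union> B" and B: "\<forall>\<beta>\<in>B. p \<beta> \<in> Rp"
    and h: "\<forall>\<beta>\<in>Rp. h \<beta> > (0::real)" "\<forall>\<beta>\<in>A. h (p \<beta>) < 0"
  shows "contains_pattern R Rp p \<Phi> P w \<longleftrightarrow>
    (\<exists>f. (\<forall>x\<in>span R. \<forall>y\<in>span R. f (x + y) = f x + f y) \<and>
         (\<forall>c. \<forall>x\<in>span R. f (c *\<^sub>R x) = c *\<^sub>R f x) \<and> f ` span R \<subseteq> span \<Phi> \<and>
         f ` A \<subseteq> inversions P w \<and> f ` B \<subseteq> P - inversions P w)"
proof -
  have "p \<beta> \<notin> Rp" if "\<beta> \<in> A" for \<beta> using h that by fastforce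
  then have eq: "inversions Rp p = A" "Rp - inversions Rp p = B" using Rp B by (auto simp: inversions_def)
  have pos: "f ` Rp \<subseteq> P" if "f ` A \<subseteq> inversions P w" "f ` B \<subseteq> P - inversions P w" for f
    using that Rp by (auto simp: inversions_def)
  show ?thesis unfolding contains_pattern_def eq(2) unfolding eq(1)
    by (rule iff_exI, rule iffI; elim conjE; intro conjI pos; assumption)
qed

lemma linear_patterns: "linear A2_pattern" "linear A3_pattern" "linear D4_pattern"
  by (simp_all only: A2_pattern_def A3_pattern_def D4_pattern_def linear_refl_prod)

lemmas pattern_linear [simp] =
  linear_patterns [THEN linear_add] linear_patterns [THEN linear_diff] linear_patterns [THEN linear_neg]

lemma contains_A2_iff:
  assumes "P \<subseteq> \<Phi>"
  shows "contains_pattern A2_roots A2_pos A2_pattern \<Phi> P w \<longleftrightarrow> pattern_A2 P w"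
proof -
  \<comment> \<open>Decreasing weights make \<open>h\<close> positive on
    \<open>evec i - evec j\<close> for \<open>i < j\<close>.\<close>
  define h :: "real ^ 3 \<Rightarrow> real" where "h x = 3 * x $ 0 + 2 * x $ 1 + x $ 2" for x
  note iff = contains_pattern_iff [OF A2_pos_eq, where h = h]
  have iff: "contains_pattern A2_roots A2_pos A2_pattern \<Phi> P w \<longleftrightarrow>
    (\<exists>f. (\<forall>x\<in>span A2_roots. \<forall>y\<in>span A2_roots. f (x + y) = f x + f y) \<and>
      (\<forall>c. \<forall>x\<in>span A2_roots. f (c *\<^sub>R x) = c *\<^sub>R f x) \<and> f ` span A2_roots \<subseteq> span \<Phi> \<and>
      f ` {evec 0 - evec 1, evec 1 - evec 2, evec 0 - evec 2} \<subseteq> inversions P w \<and> f ` {} \<subseteq> P - inversions P w)"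
    by (rule iff) (simp_all add: A2_pos_eq A2_pattern_evec h_def evec_nth)
  show ?thesis
  proof
    assume "contains_pattern A2_roots A2_pos A2_pattern \<Phi> P w"
    then obtain f where f: "\<And>x y. x \<in> span A2_roots \<Longrightarrow> y \<in> span A2_roots \<Longrightarrow> f (x + y) = f x + f y"
      "f (evec 0 - evec 1) \<in> inversions P w" "f (evec 1 - evec 2) \<in> inversions P w" "f (evec 0 - evec 2) \<in> inversions P w"
      unfolding iff by auto
    have span: "evec i - evec j \<in> span A2_roots" if "i \<noteq> j" for i j
      by (rule span_base) (use that in \<open>auto simp: roots_A_def\<close>)
    have "f (evec 0 - evec 2) = f (evec 0 - evec 1) + f (evec 1 - evec 2)"
      using f(1) [OF span span, of 0 1 1 2] by simp
    then show "pattern_A2 P w" using f unfolding pattern_A2_def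
      by (intro exI [of _ "f (evec 0 - evec 1)"] exI [of _ "f (evec 1 - evec 2)"]) simp
  next
    assume "pattern_A2 P w"
    then obtain a b where ab: "{a, b, a + b} \<subseteq> inversions P w" unfolding pattern_A2_def by blast
    then have "a \<in> span \<Phi>" "b \<in> span \<Phi>" using assms by (auto simp: inversions_def intro: span_base)
    then show "contains_pattern A2_roots A2_pos A2_pattern \<Phi> P w"
      unfolding iff using ab
      \<comment> \<open>For vectors with coordinate sum zero, the partial sums are the coefficients
        in the simple roots.\<close>
      by (intro exI [of _ "\<lambda>x. x $ 0 *\<^sub>R a + (x $ 0 + x $ 1) *\<^sub>R b"])
         (auto simp: evec_nth algebra_simps intro!: span_add span_scale)
  qed
qed

lemma contains_A3_iff:
  assumes "P \<subseteq> \<Phi>"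
  shows "contains_pattern A3_roots A3_pos A3_pattern \<Phi> P w \<longleftrightarrow> pattern_A3 P w"
proof -
  define h :: "real ^ 4 \<Rightarrow> real" where "h x = 4 * x $ 0 + 3 * x $ 1 + 2 * x $ 2 + x $ 3" for x
  note iff = contains_pattern_iff [OF A3_pos_eq, where h = h]
  have iff: "contains_pattern A3_roots A3_pos A3_pattern \<Phi> P w \<longleftrightarrow>
    (\<exists>f. (\<forall>x\<in>span A3_roots. \<forall>y\<in>span A3_roots. f (x + y) = f x + f y) \<and>
      (\<forall>c. \<forall>x\<in>span A3_roots. f (c *\<^sub>R x) = c *\<^sub>R f x) \<and> f ` span A3_roots \<subseteq> span \<Phi> \<and>
      f ` {evec 1 - evec 2, evec 0 - evec 2, evec 1 - evec 3, evec 0 - evec 3} \<subseteq> inversions P w \<and>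
      f ` {evec 0 - evec 1, evec 2 - evec 3} \<subseteq> P - inversions P w)"
    by (rule iff) (simp_all add: A3_pos_eq A3_pattern_evec h_def evec_nth)
  show ?thesis
  proof
    assume "contains_pattern A3_roots A3_pos A3_pattern \<Phi> P w"
    then obtain f where add: "\<forall>x\<in>span A3_roots. \<forall>y\<in>span A3_roots. f (x + y) = f x + f y"
      and I: "f ` {evec 1 - evec 2, evec 0 - evec 2, evec 1 - evec 3, evec 0 - evec 3} \<subseteq> inversions P w"
      and N: "f ` {evec 0 - evec 1, evec 2 - evec 3} \<subseteq> P - inversions P w"
      unfolding iff by (elim exE conjE) (rule that)
    note f = add [rule_format]
    have span: "evec i - evec j \<in> span A3_roots" if "i \<noteq> j" for i j
      by (rule span_base) (use that in \<open>auto simp: roots_A_def\<close>)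
    have "f (evec 0 - evec 2) = f (evec 0 - evec 1) + f (evec 1 - evec 2)"
      "f (evec 1 - evec 3) = f (evec 1 - evec 2) + f (evec 2 - evec 3)"
      "f (evec 0 - evec 3) = f (evec 0 - evec 1) + f (evec 1 - evec 3)"
      using f [OF span span, of 0 1 1 2] f [OF span span, of 1 2 2 3] f [OF span span, of 0 1 1 3] by simp_all
    then show "pattern_A3 P w" using I N unfolding pattern_A3_def
      by (intro exI [of _ "f (evec 0 - evec 1)"] exI [of _ "f (evec 1 - evec 2)"] exI [of _ "f (evec 2 - evec 3)"])
         (simp add: add.assoc)
  next
    assume "pattern_A3 P w"
    then obtain a b c where abc: "{a, c} \<subseteq> P - inversions P w" "{b, a + b, b + c, a + b + c} \<subseteq> inversions P w"
      unfolding pattern_A3_def by (elim exE conjE) (rule that)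
    then have "a \<in> span \<Phi>" "b \<in> span \<Phi>" "c \<in> span \<Phi>" using assms by (auto simp: inversions_def intro: span_base)
    then show "contains_pattern A3_roots A3_pos A3_pattern \<Phi> P w"
      unfolding iff using abc
      by (intro exI [of _ "\<lambda>x. x $ 0 *\<^sub>R a + (x $ 0 + x $ 1) *\<^sub>R b + (x $ 0 + x $ 1 + x $ 2) *\<^sub>R c"])
         (auto simp: evec_nth algebra_simps intro!: span_add span_scale)
  qed
qed

lemma contains_D4_iff:
  assumes "P \<subseteq> \<Phi>"
  shows "contains_pattern D4_roots D4_pos D4_pattern \<Phi> P w \<longleftrightarrow> pattern_D4 P w"
proof -
  \<comment> \<open>The weights are positive as well as decreasing, so \<open>h\<close> is also
    positive on \<open>evec i + evec j\<close>.\<close>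
  define h :: "real ^ 4 \<Rightarrow> real" where "h x = 4 * x $ 0 + 3 * x $ 1 + 2 * x $ 2 + x $ 3" for x
  note iff = contains_pattern_iff [OF D4_pos_eq, where h = h]
  have iff: "contains_pattern D4_roots D4_pos D4_pattern \<Phi> P w \<longleftrightarrow>
    (\<exists>f. (\<forall>x\<in>span D4_roots. \<forall>y\<in>span D4_roots. f (x + y) = f x + f y) \<and>
      (\<forall>c. \<forall>x\<in>span D4_roots. f (c *\<^sub>R x) = c *\<^sub>R f x) \<and> f ` span D4_roots \<subseteq> span \<Phi> \<and>
      f ` {evec 1 - evec 2, evec 0 - evec 2, evec 1 - evec 3, evec 1 + evec 3, evec 0 + evec 1} \<subseteq> inversions P w \<and>
      f ` {evec 0 - evec 1, evec 2 - evec 3, evec 2 + evec 3, evec 0 - evec 3, evec 0 + evec 3,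
     evec 1 + evec 2, evec 0 + evec 2} \<subseteq> P - inversions P w)"
    by (rule iff) (simp_all add: D4_pos_eq D4_pattern_evec h_def evec_nth add.commute)
  show ?thesis
  proof
    assume "contains_pattern D4_roots D4_pos D4_pattern \<Phi> P w"
    then obtain f where add: "\<forall>x\<in>span D4_roots. \<forall>y\<in>span D4_roots. f (x + y) = f x + f y"
      and I: "f ` {evec 1 - evec 2, evec 0 - evec 2, evec 1 - evec 3, evec 1 + evec 3, evec 0 + evec 1} \<subseteq> inversions P w"
      and N: "f ` {evec 0 - evec 1, evec 2 - evec 3, evec 2 + evec 3, evec 0 - evec 3, evec 0 + evec 3,
     evec 1 + evec 2, evec 0 + evec 2} \<subseteq> P - inversions P w"
      unfolding iff by (elim exE conjE) (rule that)
    note f = add [rule_format]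
    have span: "evec i - evec j \<in> span D4_roots" "evec i + evec j \<in> span D4_roots" if "i \<noteq> j" for i j
      by (rule span_base; use that in \<open>auto simp: roots_D_def\<close>)+
    let ?a = "f (evec 0 - evec 1)" and ?b = "f (evec 1 - evec 2)" and ?c = "f (evec 2 - evec 3)" and ?d = "f (evec 2 + evec 3)"
    have "f (evec 0 - evec 2) = ?a + ?b" "f (evec 1 - evec 3) = ?b + ?c" "f (evec 1 + evec 3) = ?b + ?d"
      "f (evec 0 - evec 3) = ?a + f (evec 1 - evec 3)" "f (evec 0 + evec 3) = ?a + f (evec 1 + evec 3)"
      "f (evec 1 + evec 2) = f (evec 1 - evec 3) + ?d" "f (evec 0 + evec 2) = ?a + f (evec 1 + evec 2)"
      "f (evec 0 + evec 1) = f (evec 0 + evec 2) + ?b"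
      using f [OF span(1) span(1), of 0 1 1 2] f [OF span(1) span(1), of 1 2 2 3] f [OF span(1) span(2), of 1 2 2 3]
        f [OF span(1) span(1), of 0 1 1 3] f [OF span(1) span(2), of 0 1 1 3] f [OF span(1) span(2), of 1 3 2 3]
        f [OF span(1) span(2), of 0 1 1 2] f [OF span(2) span(1), of 0 2 1 2]
      by (simp_all add: algebra_simps)
    then show "pattern_D4 P w" using I N unfolding pattern_D4_def
      by (intro exI [of _ ?a] exI [of _ ?b] exI [of _ ?c] exI [of _ ?d]) (simp add: ac_simps)
  next
    assume "pattern_D4 P w"
    then obtain a b c d where abcd:
      "{a, c, d, a + b + c, a + b + d, b + c + d, a + b + c + d} \<subseteq> P - inversions P w"
      "{b, a + b, b + c, b + d, a + b + b + c + d} \<subseteq> inversions P w"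
      unfolding pattern_D4_def by (elim exE conjE) (rule that)
    then have span: "a \<in> span \<Phi>" "b \<in> span \<Phi>" "c \<in> span \<Phi>" "d \<in> span \<Phi>"
      using assms by (auto simp: inversions_def intro: span_base)
    \<comment> \<open>The coefficients in the simple roots of D_4: those of \<open>c\<close> and
      \<open>d\<close> have sum \<open>x $ 0 + x $ 1 + x $ 2\<close>, and the second exceeds the
      first by \<open>x $ 3\<close>.\<close>
    let ?f = "\<lambda>x :: real ^ 4. x $ 0 *\<^sub>R a + (x $ 0 + x $ 1) *\<^sub>R b + ((x $ 0 + x $ 1 + x $ 2 - x $ 3) / 2) *\<^sub>R c +
      ((x $ 0 + x $ 1 + x $ 2 + x $ 3) / 2) *\<^sub>R d"
    have lin: "?f (x + y) = ?f x + ?f y" "?f (k *\<^sub>R x) = k *\<^sub>R ?f x" for x y :: "real ^ 4" and k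
      by (simp_all add: algebra_simps add_divide_distrib diff_divide_distrib)
    have sp: "?f ` span D4_roots \<subseteq> span \<Phi>" by (intro image_subsetI span_add span_scale span)
    have I: "?f ` {evec 1 - evec 2, evec 0 - evec 2, evec 1 - evec 3, evec 1 + evec 3, evec 0 + evec 1} \<subseteq> inversions P w"
      using abcd(2) by (simp add: evec_nth scaleR_2 ac_simps)
    have N: "?f ` {evec 0 - evec 1, evec 2 - evec 3, evec 2 + evec 3, evec 0 - evec 3, evec 0 + evec 3,
     evec 1 + evec 2, evec 0 + evec 2} \<subseteq> P - inversions P w"
      using abcd(1) by (simp add: evec_nth ac_simps)
    show "contains_pattern D4_roots D4_pos D4_pattern \<Phi> P w"
      unfolding iff by (rule exI [of _ ?f], intro conjI ballI allI lin sp I N)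
  qed
qed

theorem theorem1p3:
  fixes \<Phi> P :: "'a::euclidean_space set" and w :: "'a \<Rightarrow> 'a"
  assumes "crystallographic_root_system \<Phi>"
    and "irreducible_root_system \<Phi>"
    and "positive_system \<Phi> P"
    and "w \<in> weyl_group \<Phi>"
  shows "boolean_element \<Phi> P w \<longleftrightarrow>
           avoids_pattern A2_roots A2_pos A2_pattern \<Phi> P w \<and>
           avoids_pattern A3_roots A3_pos A3_pattern \<Phi> P w \<and>
           avoids_pattern D4_roots D4_pos D4_pattern \<Phi> P w"
proof -
  obtain v where v: "\<forall>\<alpha>\<in>\<Phi>. v \<bullet> \<alpha> \<noteq> 0" "P = {\<alpha>\<in>\<Phi>. v \<bullet> \<alpha> > 0}"
    using assms(3) unfolding positive_system_def by blast
  interpret positive_roots \<Phi> P v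
    by unfold_locales (use assms(1) v in auto)
  have sub: "P \<subseteq> \<Phi>" using pos_root by blast
  obtain xs where xs: "reduced xs" "w = refl_prod xs" using weyl_group_reduced_word assms(4) by blast
  have "boolean_element \<Phi> P w \<longleftrightarrow> distinct xs" using boolean_iff_distinct xs by blast
  also have "\<dots> \<longleftrightarrow> \<not> has_pattern P w"
    using distinct_no_pattern reduced_subset reduced_not_distinct_pattern xs by blast
  also have "\<dots> \<longleftrightarrow> \<not> pattern_A2 P w \<and> \<not> pattern_A3 P w \<and> \<not> pattern_D4 P w"
    by (simp add: has_pattern_def)
  finally show ?thesis
    unfolding contains_A2_iff [OF sub] contains_A3_iff [OF sub] contains_D4_iff [OF sub] .
qed

end
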